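(* For $w\in\mathrm{int}\,\mathcal{K}$ and $\mu>0$, let $d=d_N(w,\mu)$ and define \[ x:=\sqrt\mu\,w,\quad s:=\sqrt\mu\,w^{-1},\quad d_x:=\sqrt\mu\,Q(w^{1/2})d,\quad d_s:=-\sqrt\mu\,Q(w^{-1/2})d . \] Then: (i) $\mathrm{Exp}_x(d_x)=\sqrt\mu\,Q(w^{1/2})\exp(d)$; (ii) $\mathrm{Exp}_s(d_s)=\sqrt\mu\,Q(w^{-1/2})\exp(-d)$; (iii) $\mathrm{Exp}_x(d_x)\circ\mathrm{Exp}_s(d_s)=\mu e$.
   Context: Setting. $\mathcal{J}$ is a (finite-dimensional real) Euclidean Jordan algebra of rank $n$ with product $\circ$, identity $e$, trace $\mathrm{tr}$, inner product $\langle u,v\rangle=\mathrm{tr}(u\circ v)$ and norm $\|\cdot\|$. $\mathcal{K}=\{u\circ u:u\in\mathcal{J}\}$ is its cone of squares, with interior $\mathrm{int}\,\mathcal{K}$. Functions such as $\exp$, $u^{1/2}$, $u^{-1}$ are applied spectrally. $Q(u)v:=2u\circ(u\circ v)-(u\circ u)\circ v$. $\mathcal{L}\subseteq\mathcal{J}$ is a linear subspace with orthogonal complement $\mathcal{L}^\perp$, and $x_0,s_0\in\mathcal{J}$. Standing assumption (Slater): $\mathrm{int}\,\mathcal{K}\cap(x_0+\mathcal{L})\neq\emptyset$ and $\mathrm{int}\,\mathcal{K}\cap(s_0+\mathcal{L}^\perp)\ne\emptyset$. Newton direction. For $w\in\mathrm{int}\,\mathcal{K}$ and $\mu>0$, $d_N(w,\mu)$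 is the unique $d\in\mathcal{J}$ with $Q(w^{1/2})(e+d)\in\frac1{\sqrt\mu}x_0+\mathcal{L}$ and $Q(w^{-1/2})(e-d)\in\frac1{\sqrt\mu}s_0+\mathcal{L}^\perp$. Riemannian exponential map. $\mathrm{int}\,\mathcal{K}$ is a Riemannian manifold with local norm $\|v\|_u=\|Q(u)^{-1/2}v\|$ at $u$. For $u\in\mathrm{int}\,\mathcal{K}$, $\mathrm{Exp}_u:\mathcal{J}\to\mathrm{int}\,\mathcal{K}$ is its exponential map: $\mathrm{Exp}_u(v)=g(1)$ where $g$ is the geodesic with $g(0)=u$, $\dot g(0)=v$. Explicitly (known formula) $\mathrm{Exp}_u(v)=Q(u^{1/2})\exp(Q(u^{-1/2})v)$. *)

theory Defs
  imports "HOL-Analysis.Analysis"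
begin

section \<open>Euclidean Jordan algebras\<close>

class jordan_algebra = real_vector +
  fixes jprod :: "'a \<Rightarrow> 'a \<Rightarrow> 'a" (infixl "\<star>" 70)
    and junit :: 'a
  assumes jprod_commute: "u \<star> v = v \<star> u"
    and jprod_add_left: "(u + v) \<star> z = u \<star> z + v \<star> z"
    and jprod_scaleR_left: "(r *\<^sub>R u) \<star> v = r *\<^sub>R (u \<star> v)"
    and junit_left: "junit \<star> u = u"
    and jordan_identity: "u \<star> ((u \<star> u) \<star> v) = (u \<star> u) \<star> (u \<star> v)"
begin

definition primitive_idempotent :: "'a \<Rightarrow> bool" where
  "primitive_idempotent c \<longleftrightarrow> c \<noteq> 0 \<and> c \<star> c = c \<and>
     \<not> (\<exists>a b. a \<noteq> 0 \<and> b \<noteq> 0 \<and> a \<star> a = a \<and> b \<star> b = b \<and> a \<star> b = 0 \<and> c = a + b)"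

definition jordan_frame :: "'a set \<Rightarrow> bool" where
  "jordan_frame C \<longleftrightarrow> finite C \<and> (\<forall>c\<in>C. primitive_idempotent c) \<and>
     (\<forall>c\<in>C. \<forall>c'\<in>C. c \<noteq> c' \<longrightarrow> c \<star> c' = 0) \<and> (\<Sum>c\<in>C. c) = junit"

definition spectral_decomposition :: "'a \<Rightarrow> 'a set \<Rightarrow> ('a \<Rightarrow> real) \<Rightarrow> bool" where
  "spectral_decomposition u C ev \<longleftrightarrow> jordan_frame C \<and> u = (\<Sum>c\<in>C. ev c *\<^sub>R c)"

text \<open>In a Euclidean Jordan algebra every element has a spectral decomposition, and the sum of the
  eigenvalues does not depend on its choice.\<close>

definition jtrace :: "'a \<Rightarrow> real" where
  "jtrace u = (THE t. \<exists>C ev. spectral_decomposition u C ev \<and> t = (\<Sum>c\<in>C. ev c))"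

end

text \<open>The inner product of the type class \<open>euclidean_space\<close> (hence also its norm and its orthogonal
  complements) is required to be the trace inner product.\<close>

class euclidean_jordan_algebra = euclidean_space + jordan_algebra +
  assumes inner_jprod: "inner (u \<star> v) z = inner v (u \<star> z)"
    and inner_eq_jtrace: "inner u v = jtrace (u \<star> v)"

primrec jpower :: "'a::jordan_algebra \<Rightarrow> nat \<Rightarrow> 'a" where
  "jpower u 0 = junit"
| "jpower u (Suc k) = u \<star> jpower u k"

text \<open>The dimension of the span of the powers of \<open>u\<close> is the degree of the minimal polynomial
  of \<open>u\<close>; the rank is the largest such degree.\<close>

definition jrank :: "'a::euclidean_jordan_algebra itself \<Rightarrow> nat" where
  "jrank _ = Max (range (\<lambda>u :: 'a. dim (span (range (jpower u)))))"

definition cone_of_squares :: "'a::euclidean_jordan_algebra set" where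
  "cone_of_squares = range (\<lambda>u. u \<star> u)"

definition quad :: "'a::euclidean_jordan_algebra \<Rightarrow> 'a \<Rightarrow> 'a" where
  "quad u v = 2 *\<^sub>R (u \<star> (u \<star> v)) - (u \<star> u) \<star> v"

text \<open>Spectral functions: the real function is applied to the eigenvalues, and the result does
  not depend on the decomposition.\<close>

definition spectral_map ::
    "(real \<Rightarrow> real) \<Rightarrow> 'a::euclidean_jordan_algebra \<Rightarrow> 'a" where
  "spectral_map f u =
     (THE y. \<exists>C ev. spectral_decomposition u C ev \<and> y = (\<Sum>c\<in>C. f (ev c) *\<^sub>R c))"

definition jexp :: "'a::euclidean_jordan_algebra \<Rightarrow> 'a" where
  "jexp = spectral_map exp"

definition jsqrt :: "'a::euclidean_jordan_algebra \<Rightarrow> 'a" where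
  "jsqrt = spectral_map sqrt"

definition jinverse :: "'a::euclidean_jordan_algebra \<Rightarrow> 'a" where
  "jinverse = spectral_map inverse"

definition jinvsqrt :: "'a::euclidean_jordan_algebra \<Rightarrow> 'a" where
  "jinvsqrt = spectral_map (\<lambda>t. inverse (sqrt t))"

section \<open>Newton direction\<close>

definition newton_direction ::
    "'a::euclidean_jordan_algebra set \<Rightarrow> 'a \<Rightarrow> 'a \<Rightarrow> 'a \<Rightarrow> real \<Rightarrow> 'a" where
  "newton_direction L x0 s0 w \<mu> =
     (THE d. quad (jsqrt w) (junit + d) \<in> (+) ((1 / sqrt \<mu>) *\<^sub>R x0) ` L \<and>
             quad (jinvsqrt w) (junit - d) \<in> (+) ((1 / sqrt \<mu>) *\<^sub>R s0) ` (L\<^sup>\<bottom>))"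

section \<open>Geodesics and the Riemannian exponential map\<close>

text \<open>A Riemannian metric on an open subset \<open>M\<close> of a Euclidean space is given as a function
  \<open>G\<close>, where \<open>G p\<close> is the inner product at the point \<open>p\<close>. The Christoffel symbols of the first
  kind are half of \<open>D\<^sub>a G(b,z) + D\<^sub>b G(a,z) - D\<^sub>z G(a,b)\<close>, where \<open>D\<^sub>a\<close> is the directional
  derivative in the base point.\<close>

definition christoffel ::
    "('a::real_normed_vector \<Rightarrow> 'a \<Rightarrow> 'a \<Rightarrow> real) \<Rightarrow> 'a \<Rightarrow> 'a \<Rightarrow> 'a \<Rightarrow> 'a \<Rightarrow> real" where
  "christoffel G p a b z =
     (frechet_derivative (\<lambda>q. G q b z) (at p) a
    + frechet_derivative (\<lambda>q. G q a z) (at p) b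
    - frechet_derivative (\<lambda>q. G q a b) (at p) z) / 2"

text \<open>The last conjunct says that the Levi-Civita covariant derivative of the velocity along the
  curve vanishes, tested against every vector \<open>z\<close> in the metric at \<open>g t\<close>.\<close>

definition geodesic_on ::
    "'a::real_normed_vector set \<Rightarrow> ('a \<Rightarrow> 'a \<Rightarrow> 'a \<Rightarrow> real) \<Rightarrow> real set \<Rightarrow>
     (real \<Rightarrow> 'a) \<Rightarrow> (real \<Rightarrow> 'a) \<Rightarrow> bool" where
  "geodesic_on M G I g g' \<longleftrightarrow>
     (\<exists>g''. \<forall>t\<in>I. g t \<in> M \<and>
        (g has_vector_derivative g' t) (at t within I) \<and>
        (g' has_vector_derivative g'' t) (at t within I) \<and>
        (\<forall>z. G (g t) (g'' t) z + christoffel G (g t) (g' t) (g' t) z = 0))"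

definition riemannian_exp ::
    "'a::real_normed_vector set \<Rightarrow> ('a \<Rightarrow> 'a \<Rightarrow> 'a \<Rightarrow> real) \<Rightarrow> 'a \<Rightarrow> 'a \<Rightarrow> 'a" where
  "riemannian_exp M G u v =
     (THE y. \<exists>g g'. geodesic_on M G {0..1} g g' \<and> g 0 = u \<and> g' 0 = v \<and> y = g 1)"

text \<open>\<open>A\<^sup>-\<^sup>1\<^sup>/\<^sup>2\<close> for a self-adjoint positive definite operator \<open>A\<close>: the unique self-adjoint positive
  semidefinite operator whose square is the inverse of \<open>A\<close>.\<close>

definition operator_invsqrt :: "('a::euclidean_space \<Rightarrow> 'a) \<Rightarrow> 'a \<Rightarrow> 'a" where
  "operator_invsqrt A =
     (THE T. linear T \<and> (\<forall>u v. inner (T u) v = inner u (T v)) \<and> (\<forall>v. 0 \<le> inner v (T v)) \<and>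
             (\<forall>v. T (T (A v)) = v))"

definition local_norm :: "'a::euclidean_jordan_algebra \<Rightarrow> 'a \<Rightarrow> real" where
  "local_norm u v = norm (operator_invsqrt (quad u) v)"

definition local_inner :: "'a::euclidean_jordan_algebra \<Rightarrow> 'a \<Rightarrow> 'a \<Rightarrow> real" where
  "local_inner u v z = inner (operator_invsqrt (quad u) v) (operator_invsqrt (quad u) z)"

lemma local_norm_eq_sqrt_local_inner: "local_norm u v = sqrt (local_inner u v v)"
  by (simp add: local_norm_def local_inner_def norm_eq_sqrt_inner)

definition cone_Exp :: "'a::euclidean_jordan_algebra \<Rightarrow> 'a \<Rightarrow> 'a" where
  "cone_Exp = riemannian_exp (interior cone_of_squares) local_inner"

end

theory Submission
  imports Defs "HOL-Computational_Algebra.Polynomial"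
begin

text \<open>
  The linearized Jordan identity shows that the flow of the linear vector field \<open>2 x \<star> _\<close>, which is
  \<open>quad (exp (t x))\<close>, preserves the quadratic representation:
  \<open>quad (quad p y) = quad p \<circ> quad y \<circ> quad p\<close> for \<open>p\<close> in the open cone, where every element is an
  exponential. Hence \<open>quad p\<close> is an isometry of the open cone and
  \<open>(quad p y)\<^sup>-\<^sup>1 = quad p\<^sup>-\<^sup>1 y\<^sup>-\<^sup>1\<close>, which gives (iii).

  In terms of the position \<open>g\<close> and the momentum \<open>b = quad g\<^sup>-\<^sup>1 g'\<close>, the geodesic equation is the polynomial
  system \<open>g' = quad g b\<close>, \<open>b' = - quad b g\<close>. It has unique solutions by Gronwall's inequality, and
  it is solved by \<open>g = quad p (exp (t d))\<close>, \<open>b = quad p\<^sup>-\<^sup>1 (d \<star> exp (- t d))\<close>.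
\<close>

section \<open>Identities in Jordan algebras\<close>

text \<open>Spectral functions, \<open>operator_invsqrt\<close> and the exponential map are definite
  descriptions, so each needs a uniqueness proof: by polynomial interpolation, by an eigenvector of
  the difference of two candidate roots, and by uniqueness for the flow. The fundamental formula
  \<open>quad (quad p y) z = quad p (quad y (quad p z))\<close> has total degree seven and is not
  expanded from the Jordan identity. Differentiated along exponentials it becomes
  \<open>jprod_quad_polar\<close>, which takes two instances of the linearized identity.
  \<open>jinverse\<close> is never differentiated by itself: the metric contains it only through
  \<open>quad (jinverse q)\<close>, the operator inverse of the polynomial \<open>quad q\<close>,
  whose derivative follows from the resolvent identity. In momentum form the inverse disappears from
  the equation. The vector field is then polynomial on the whole algebra and Lipschitz on bounded
  sets, so uniqueness needs no control of the distance to the boundary of the cone.\<close>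

lemma jprod_add_right: "(z::'a::jordan_algebra) \<star> (u + v) = z \<star> u + z \<star> v"
  by (metis jprod_add_left jprod_commute)

lemma jprod_scaleR_right: "(u::'a::jordan_algebra) \<star> (r *\<^sub>R v) = r *\<^sub>R (u \<star> v)"
  by (metis jprod_scaleR_left jprod_commute)

lemma junit_right: "(u::'a::jordan_algebra) \<star> junit = u"
  by (metis junit_left jprod_commute)

lemma jprod_zero_left [simp]: "0 \<star> (u::'a::jordan_algebra) = 0"
  using jprod_scaleR_left[of 0 0 u] by simp

lemma jprod_zero_right [simp]: "(u::'a::jordan_algebra) \<star> 0 = 0"
  by (metis jprod_zero_left jprod_commute)

lemma jprod_minus_left: "(- (u::'a::jordan_algebra)) \<star> v = - (u \<star> v)"
  using jprod_scaleR_left[of "-1" u v] by simp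

lemma jprod_minus_right: "(u::'a::jordan_algebra) \<star> (- v) = - (u \<star> v)"
  by (metis jprod_minus_left jprod_commute)

lemma jprod_diff_left: "((u::'a::jordan_algebra) - v) \<star> z = u \<star> z - v \<star> z"
  using jprod_add_left[of u "- v" z] by (simp add: jprod_minus_left)

lemma jprod_diff_right: "(z::'a::jordan_algebra) \<star> (u - v) = z \<star> u - z \<star> v"
  by (metis jprod_diff_left jprod_commute)

lemma jprod_sum_left: "(\<Sum>i\<in>I. f i) \<star> (z::'a::jordan_algebra) = (\<Sum>i\<in>I. f i \<star> z)"
  by (induction I rule: infinite_finite_induct) (simp_all add: jprod_add_left)

lemma jprod_sum_right: "(z::'a::jordan_algebra) \<star> (\<Sum>i\<in>I. f i) = (\<Sum>i\<in>I. z \<star> f i)"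
  by (induction I rule: infinite_finite_induct) (simp_all add: jprod_add_right)

lemmas jprod_simps = jprod_add_left jprod_add_right jprod_scaleR_left jprod_scaleR_right
  jprod_minus_left jprod_minus_right jprod_diff_left jprod_diff_right

text \<open>Polarization of the Jordan identity: the defect \<open>T a b c\<close> is trilinear,
  symmetric in its last two arguments and zero on the diagonal, so its cyclic sum vanishes.\<close>

lemma jordan_linearized:
  "(x::'a::jordan_algebra) \<star> ((y \<star> z) \<star> w) + y \<star> ((z \<star> x) \<star> w) + z \<star> ((x \<star> y) \<star> w)
   = (y \<star> z) \<star> (x \<star> w) + (z \<star> x) \<star> (y \<star> w) + (x \<star> y) \<star> (z \<star> w)"
proof -
  define T where "T a b c = a \<star> ((b \<star> c) \<star> w) - (b \<star> c) \<star> (a \<star> w)" for a b c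
  have T0: "T a a a = 0" for a
    by (simp add: T_def jordan_identity)
  have Tc: "T a c b = T a b c" for a b c
    by (simp add: T_def jprod_commute[of c b])
  have T1: "T (a + a') b c = T a b c + T a' b c" for a a' b c
    by (simp add: T_def jprod_simps)
  have T2: "T a (b + b') c = T a b c + T a b' c" for a b b' c
    by (simp add: T_def jprod_simps)
  have T3: "T a b (c + c') = T a b c + T a b c'" for a b c c'
    by (simp add: T_def jprod_simps)
  \<comment> \<open>The part of \<open>T (a + b) (a + b) (a + b)\<close> that is linear in
    \<open>b\<close>; replacing \<open>b\<close> by \<open>- b\<close> separates it from the
    quadratic part.\<close>
  have two: "T b a a + (T a a b + T a a b) = 0" for a b
  proof -
    have p: "T (a + b) (a + b) (a + b) = 0" and m: "T (a + - b) (a + - b) (a + - b) = 0"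
      by (rule T0)+
    have neg: "T (- p) q r = - T p q r" "T q (- p) r = - T q p r" "T q r (- p) = - T q r p"
      for p q r
      by (simp_all add: T_def jprod_minus_left jprod_minus_right)
    have "(T b a a + (T a a b + T a a b)) + (T a b b + (T b a b + T b a b)) = 0"
      using p unfolding T1 T2 T3 by (simp add: T0 Tc[of b b a] Tc[of a b a] algebra_simps)
    moreover have "- (T b a a + (T a a b + T a a b)) + (T a b b + (T b a b + T b a b)) = 0"
      using m unfolding T1 T2 T3 neg by (simp add: T0 Tc[of b b a] Tc[of a b a] algebra_simps)
    ultimately have "2 *\<^sub>R (T b a a + (T a a b + T a a b)) = 0"
      unfolding scaleR_2 by (metis add.right_inverse add_eq_0_iff eq_neg_iff_add_eq_0)
    then show ?thesis by simp
  qed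
  \<comment> \<open>Second polarization: \<open>two\<close> at \<open>a = x + y\<close>,
    \<open>b = z\<close>, minus its values at \<open>a = x\<close> and \<open>a = y\<close>.\<close>
  have "2 *\<^sub>R (T x y z + T y z x + T z x y)
     = (T z (x + y) (x + y) + (T (x + y) (x + y) z + T (x + y) (x + y) z))
     - (T z x x + (T x x z + T x x z)) - (T z y y + (T y y z + T y y z))"
    unfolding T1 T2 T3 Tc[of z y x] Tc[of y z x] scaleR_2 by (simp add: algebra_simps)
  then have "T x y z + T y z x + T z x y = 0"
    unfolding two by simp
  then show ?thesis
    by (simp add: T_def algebra_simps)
qed

text \<open>In the linearized identity at \<open>c, c, c'\<close> a single term survives on each
  side.\<close>

lemma orthogonal_idempotents_commute:
  fixes c :: "'a::jordan_algebra"
  assumes "c \<star> c = c" "c \<star> c' = 0"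
  shows "c \<star> (c' \<star> v) = c' \<star> (c \<star> v)"
  using jordan_linearized[of c c c' v] assms by (simp add: jprod_commute)

lemma scaleR_three: "3 *\<^sub>R (v::'a::real_vector) = v + (v + v)"
  using scaleR_left_distrib[of 2 1 v] by (simp add: scaleR_2)

text \<open>Peirce decomposition in operator form: multiplication by \<open>c\<close> is annihilated
  by \<open>t * (2 * t - 1) * (t - 1)\<close>, so its only possible eigenvalues are 0, 1/2 and
  1.\<close>

lemma idempotent_cubic:
  fixes c :: "'a::jordan_algebra"
  assumes "c \<star> c = c"
  shows "2 *\<^sub>R (c \<star> (c \<star> (c \<star> v))) - 3 *\<^sub>R (c \<star> (c \<star> v)) + c \<star> v = 0"
proof -
  have "c \<star> ((c \<star> v) \<star> c) + c \<star> ((v \<star> c) \<star> c) + v \<star> ((c \<star> c) \<star> c)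
     = (c \<star> v) \<star> (c \<star> c) + (v \<star> c) \<star> (c \<star> c) + (c \<star> c) \<star> (v \<star> c)"
    by (rule jordan_linearized)
  then have "2 *\<^sub>R (c \<star> (c \<star> (c \<star> v))) + c \<star> v = 3 *\<^sub>R (c \<star> (c \<star> v))"
    using assms by (simp add: jprod_commute scaleR_2 scaleR_three algebra_simps)
  then show ?thesis
    by (simp add: algebra_simps)
qed

text \<open>Peirce rule: an element of the 1-space of \<open>c\<close> and one of the 0-space have
  product zero. The linearized identity counts \<open>a \<star> c'\<close> twice on the left and
  once on the right. When \<open>c\<close> is split, this keeps its parts orthogonal to the rest of
  a frame.\<close>

lemma split_idempotent_orthogonal:
  fixes c :: "'a::jordan_algebra"
  assumes "c \<star> c = c" "c' \<star> c = 0" "a \<star> c = a"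
  shows "a \<star> c' = 0"
proof -
  have comm: "c \<star> (c' \<star> v) = c' \<star> (c \<star> v)" for v
    using orthogonal_idempotents_commute assms by (metis jprod_commute)
  have ac': "c \<star> (a \<star> c') = a \<star> c'"
    using comm[of a] assms by (simp add: jprod_commute)
  have "c \<star> ((a \<star> c') \<star> c) + a \<star> ((c' \<star> c) \<star> c) + c' \<star> ((c \<star> a) \<star> c)
     = (a \<star> c') \<star> (c \<star> c) + (c' \<star> c) \<star> (a \<star> c) + (c \<star> a) \<star> (c' \<star> c)"
    by (rule jordan_linearized)
  then show ?thesis
    using assms ac' by (simp add: jprod_commute)
qed

text \<open>The Jordan triple product of \<open>a\<close>, \<open>v\<close>, \<open>b\<close>: the
  polarization of \<open>quad\<close>, normalised so that it agrees with \<open>quad\<close> for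
  \<open>a = b\<close>.\<close>

definition quad_polar :: "'a::jordan_algebra \<Rightarrow> 'a \<Rightarrow> 'a \<Rightarrow> 'a" where
  "quad_polar a b v = a \<star> (b \<star> v) + b \<star> (a \<star> v) - (a \<star> b) \<star> v"

text \<open>Infinitesimal form of the fundamental formula: up to a factor 2, the derivative at
  \<open>t = 0\<close> of that formula with \<open>exp (t x)\<close> in place of \<open>p\<close>.
  The instance \<open>1\<close> of the linearized identity rewrites
  \<open>((x \<star> y) \<star> y) \<star> v\<close>, and \<open>2\<close> closes the gap.\<close>

lemma jprod_quad_polar:
  "x \<star> quad y v + quad y (x \<star> v) = 2 *\<^sub>R quad_polar (x \<star> y) y v"
proof -
  have "v \<star> ((x \<star> y) \<star> y) + x \<star> ((y \<star> v) \<star> y) + y \<star> ((v \<star> x) \<star> y)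
     = (x \<star> y) \<star> (v \<star> y) + (y \<star> v) \<star> (x \<star> y) + (v \<star> x) \<star> (y \<star> y)"
    by (rule jordan_linearized)
  then have 1: "((x \<star> y) \<star> y) \<star> v = 2 *\<^sub>R ((x \<star> y) \<star> (y \<star> v)) + (y \<star> y) \<star> (x \<star> v)
      - x \<star> (y \<star> (y \<star> v)) - y \<star> (y \<star> (x \<star> v))"
    by (simp add: jprod_commute scaleR_2 algebra_simps)
  have 2: "x \<star> ((y \<star> y) \<star> v) + y \<star> ((y \<star> x) \<star> v) + y \<star> ((x \<star> y) \<star> v)
     = (y \<star> y) \<star> (x \<star> v) + (y \<star> x) \<star> (y \<star> v) + (x \<star> y) \<star> (y \<star> v)"
    by (rule jordan_linearized)
  show ?thesis
    unfolding quad_def quad_polar_def 1 using 2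
    by (simp add: jprod_simps jprod_commute scaleR_2 algebra_simps)
qed

section \<open>The spectral theorem\<close>

lemma jprod_selfadjoint: "inner u (c \<star> v) = inner (c \<star> u) (v::'a::euclidean_jordan_algebra)"
  by (simp add: inner_jprod)

text \<open>With \<open>L\<close> the self-adjoint multiplication by \<open>c\<close>, the cubic
  relation gives \<open>L = (2 L^2 - L)^2 + 8 (L - L^2)^2\<close>, a sum of squares. The numbers
  \<open>a1\<close> to \<open>a4\<close> are the moments of \<open>L\<close> at
  \<open>v\<close>.\<close>

lemma idempotent_psd:
  fixes c v :: "'a::euclidean_jordan_algebra"
  assumes "c \<star> c = c"
  shows "0 \<le> inner (c \<star> v) v"
proof -
  define a1 a2 a3 a4 where "a1 = inner (c \<star> v) v" and "a2 = inner (c \<star> v) (c \<star> v)"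
    and "a3 = inner (c \<star> v) (c \<star> (c \<star> v))" and "a4 = inner (c \<star> (c \<star> v)) (c \<star> (c \<star> v))"
  note cubic = idempotent_cubic[OF assms, of v]
  have "inner v (2 *\<^sub>R (c \<star> (c \<star> (c \<star> v))) - 3 *\<^sub>R (c \<star> (c \<star> v)) + c \<star> v) = 0"
    "inner (c \<star> v) (2 *\<^sub>R (c \<star> (c \<star> (c \<star> v))) - 3 *\<^sub>R (c \<star> (c \<star> v)) + c \<star> v) = 0"
    using cubic by simp_all
  moreover have "inner v (c \<star> x) = inner (c \<star> v) x" "inner (c \<star> v) (c \<star> x) = inner (c \<star> (c \<star> v)) x" for x
    by (rule jprod_selfadjoint)+
  ultimately have 1: "2 * a3 - 3 * a2 + a1 = 0" "2 * a4 - 3 * a3 + a2 = 0"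
    unfolding a1_def a2_def a3_def a4_def
    by (simp_all add: inner_diff_right inner_add_right)
  have "0 \<le> inner (2 *\<^sub>R (c \<star> (c \<star> v)) - c \<star> v) (2 *\<^sub>R (c \<star> (c \<star> v)) - c \<star> v)"
    "0 \<le> inner (c \<star> v - c \<star> (c \<star> v)) (c \<star> v - c \<star> (c \<star> v))"
    by (rule inner_ge_zero)+
  then have "0 \<le> 4 * a4 - 4 * a3 + a2" "0 \<le> a2 - 2 * a3 + a4"
    unfolding a1_def a2_def a3_def a4_def
    by (simp_all add: inner_diff_right inner_diff_left inner_commute algebra_simps)
  with 1 have "0 \<le> a1" by linarith
  then show ?thesis by (simp add: a1_def)
qed

section \<open>Power associativity and the algebra generated by one element\<close>

lemma linear_jprod: "linear ((\<star>) (u::'a::jordan_algebra))"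
  by (rule linearI) (simp_all add: jprod_simps)

abbreviation power_algebra :: "'a::euclidean_jordan_algebra \<Rightarrow> 'a set" where
  "power_algebra u \<equiv> span (range (jpower u))"

lemma jpower_two_mult: "(u \<star> u) \<star> jpower u j = jpower u (Suc (Suc j))"
  by (induction j) (simp_all add: junit_right flip: jordan_identity)

text \<open>For \<open>k = m + 2\<close> the linearized identity at \<open>jpower u j\<close>,
  \<open>u\<close>, \<open>jpower u m\<close>, with fourth argument \<open>u\<close>, contains the
  wanted product once. The other terms are covered by the exponents \<open>m\<close> and
  \<open>m + 1\<close>, for every \<open>j\<close>, or by \<open>jpower_two_mult\<close>.\<close>

lemma jpower_mult: "jpower u k \<star> jpower u j = jpower u (k + j)"
proof (induction k arbitrary: j rule: less_induct)
  case (less k)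
  consider "k = 0" | "k = 1" | m where "k = Suc (Suc m)"
    by (metis One_nat_def not0_implies_Suc)
  then show ?case
  proof cases
    case (3 m)
    have "jpower u j \<star> ((u \<star> jpower u m) \<star> u) + u \<star> ((jpower u m \<star> jpower u j) \<star> u)
        + jpower u m \<star> ((jpower u j \<star> u) \<star> u)
      = (u \<star> jpower u m) \<star> (jpower u j \<star> u) + (jpower u m \<star> jpower u j) \<star> (u \<star> u)
        + (jpower u j \<star> u) \<star> (jpower u m \<star> u)"
      by (rule jordan_linearized)
    moreover have "jpower u m \<star> jpower u i = jpower u (m + i)"
      "jpower u (Suc m) \<star> jpower u i = jpower u (Suc m + i)" for i
      using less[of m i] less[of "Suc m" i] 3 by simp_all
    moreover have "(u \<star> jpower u m) \<star> u = jpower u k" "(jpower u m \<star> jpower u j) \<star> u = jpower u (m + Suc j)"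
      "(jpower u j \<star> u) \<star> u = jpower u (Suc (Suc j))" "u \<star> jpower u m = jpower u (Suc m)"
      "jpower u j \<star> u = jpower u (Suc j)" "jpower u m \<star> u = jpower u (Suc m)"
      using less[of m j] 3 by (simp_all add: jprod_commute)
    moreover have "jpower u (m + j) \<star> (u \<star> u) = jpower u (k + j)"
      using 3 jpower_two_mult[of u "m + j"] by (simp add: jprod_commute)
    moreover have "jpower u (Suc j) \<star> jpower u (Suc m) = jpower u (Suc m) \<star> jpower u (Suc j)"
      "jpower u j \<star> jpower u k = jpower u k \<star> jpower u j"
      by (rule jprod_commute)+
    moreover have "u \<star> jpower u (m + Suc j) = jpower u (k + j)" "Suc m + Suc j = k + j"
      "m + Suc (Suc j) = k + j"
      using 3 by simp_all
    ultimately show ?thesis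
      by (metis add_right_cancel)
  qed (simp_all add: junit_left junit_right)
qed

lemma jprod_span:
  fixes a b :: "'a::jordan_algebra"
  assumes "a \<in> span A" "b \<in> span B"
    and "\<And>x y. x \<in> A \<Longrightarrow> y \<in> B \<Longrightarrow> x \<star> y \<in> span D"
  shows "a \<star> b \<in> span D"
  using assms(1)
proof (induction rule: span_induct)
  case base
  show ?case
    by (auto intro!: subspaceI simp: jprod_simps span_add span_scale span_zero)
next
  case (step x)
  show ?case
    using assms(2)
  proof (induction rule: span_induct)
    case base
    show ?case
      by (auto intro!: subspaceI simp: jprod_simps span_add span_scale span_zero)
  qed (use assms(3) step in auto)
qed

lemma power_algebra_mult:
  assumes "a \<in> power_algebra u" "b \<in> power_algebra u"
  shows "a \<star> b \<in> power_algebra u"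
  using assms by (rule jprod_span) (auto simp: jpower_mult intro: span_base)

lemma power_algebra_assoc:
  assumes "a \<in> power_algebra u" "b \<in> power_algebra u" "z \<in> power_algebra u"
  shows "a \<star> (b \<star> z) = (a \<star> b) \<star> z"
  using assms(1)
proof (induction rule: span_induct)
  case base
  show ?case
    by (auto intro!: subspaceI simp: jprod_simps)
next
  case (step x)
  show ?case
    using assms(2)
  proof (induction rule: span_induct)
    case base
    show ?case
      by (auto intro!: subspaceI simp: jprod_simps)
  next
    case (step y)
    show ?case
      using assms(3)
    proof (induction rule: span_induct)
      case base
      show ?case
        by (auto intro!: subspaceI simp: jprod_simps)
    next
      case (step v)
      with \<open>x \<in> range (jpower u)\<close> \<open>y \<in> range (jpower u)\<close> show ?case
        by (auto simp: jpower_mult add.assoc)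
    qed
  qed
qed

lemma jpower_in_power_algebra: "jpower u k \<in> power_algebra u"
  by (simp add: span_base)

lemma junit_in_power_algebra: "junit \<in> power_algebra u"
  using jpower_in_power_algebra[of u 0] by simp

lemma self_in_power_algebra: "u \<in> power_algebra u"
  using jpower_in_power_algebra[of u 1] by (simp add: junit_right)

text \<open>Applied with \<open>y = z\<close>: the square of an eigenvector \<open>z\<close> is a
  multiple of \<open>z\<close>, so rescaling can turn \<open>z\<close> into an idempotent.\<close>

lemma power_algebra_eigenvector_mult:
  assumes "y \<in> power_algebra u" "z \<in> power_algebra u" "u \<star> z = l *\<^sub>R z"
  shows "\<exists>r. y \<star> z = r *\<^sub>R z"
  using assms(1)
proof (induction rule: span_induct)
  case base
  have "\<exists>r. (x + y) \<star> z = r *\<^sub>R z" if "\<exists>r. x \<star> z = r *\<^sub>R z" "\<exists>r. y \<star> z = r *\<^sub>R z" for x y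
    using that by (metis jprod_add_left scaleR_left_distrib)
  moreover have "\<exists>r. (c *\<^sub>R x) \<star> z = r *\<^sub>R z" if "\<exists>r. x \<star> z = r *\<^sub>R z" for c x
    using that by (metis jprod_scaleR_left scaleR_scaleR)
  moreover have "\<exists>r. 0 \<star> z = r *\<^sub>R z"
    by (rule exI[of _ 0]) simp
  ultimately show ?case
    by (simp add: subspace_def)
next
  case (step x)
  then obtain k where x: "x = jpower u k" by auto
  have "jpower u k \<star> z = l ^ k *\<^sub>R z" for k
  proof (induction k)
    case (Suc k)
    have "jpower u (Suc k) \<star> z = jpower u k \<star> (u \<star> z)"
      using power_algebra_assoc[of "jpower u k" u u z] assms(2)
      by (simp add: jprod_commute[of u "jpower u k"] jpower_in_power_algebra self_in_power_algebra)
    then show ?case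
      using Suc assms(3) by (simp add: jprod_scaleR_right)
  qed (simp add: junit_left)
  with x show ?case by blast
qed

section \<open>Eigenvectors of self-adjoint maps\<close>

lemma linear_coeff_zero:
  fixes A B :: real
  assumes "\<And>t. 0 \<le> 2 * t * B + t\<^sup>2 * A"
  shows "B = 0"
proof (rule ccontr)
  assume "B \<noteq> 0"
  \<comment> \<open>At \<open>t = - (B / m)\<close> the polynomial equals
    \<open>(B / m)^2 * (A - 2 * m)\<close>, which is negative because \<open>m\<close> exceeds
    \<open>\<bar>A\<bar>\<close>.\<close>
  define m where "m = \<bar>A\<bar> + 1"
  have "0 \<le> 2 * (- (B / m)) * B + (- (B / m))\<^sup>2 * A"
    by (rule assms)
  also have "\<dots> = (B / m)\<^sup>2 * (A - 2 * m)"
  proof -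
    have "m \<noteq> 0" by (simp add: m_def)
    then show ?thesis by (simp add: power2_eq_square field_simps)
  qed
  finally have "0 \<le> (B / m)\<^sup>2 * (A - 2 * m)" .
  moreover have "m > 0"
    by (simp add: m_def)
  ultimately have "0 \<le> A - 2 * m"
    using \<open>B \<noteq> 0\<close> by (simp add: zero_le_mult_iff)
  then show False
    using abs_ge_self[of A] abs_ge_zero[of A] by (simp add: m_def)
qed

text \<open>The Rayleigh quotient attains its maximum \<open>l\<close> on the compact unit sphere of
  \<open>W\<close>. The first variation at the maximum vanishes in the direction
  \<open>l *\<^sub>R z - f z\<close>, which lies in \<open>W\<close> by invariance; hence that
  vector is zero.\<close>

lemma selfadjoint_eigenvector:
  fixes f :: "'a::euclidean_space \<Rightarrow> 'a"
  assumes f: "linear f" and sa: "\<And>u v. inner (f u) v = inner u (f v)"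
    and W: "subspace W" "f ` W \<subseteq> W" "W \<noteq> {0}"
  obtains z l where "z \<in> W" "z \<noteq> 0" "f z = l *\<^sub>R z"
proof -
  interpret f: linear f by (rule f)
  obtain w where w: "w \<in> W" "w \<noteq> 0"
    using W subspace_0 by blast
  have "compact (sphere 0 1 \<inter> W)"
    using W by (simp add: closed_subspace compact_Int_closed)
  moreover have "(1 / norm w) *\<^sub>R w \<in> sphere 0 1 \<inter> W"
    using w W by (simp add: subspace_scale)
  moreover have "continuous_on (sphere 0 1 \<inter> W) (\<lambda>v. inner (f v) v)"
    by (intro continuous_intros linear_continuous_on linear_conv_bounded_linear[THEN iffD1] f)
  ultimately obtain z where z: "z \<in> sphere 0 1 \<inter> W"
    and max: "\<And>v. v \<in> sphere 0 1 \<inter> W \<Longrightarrow> inner (f v) v \<le> inner (f z) z"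
    using continuous_attains_sup[of "sphere 0 1 \<inter> W" "\<lambda>v. inner (f v) v"] by blast
  define l where "l = inner (f z) z"
  have q: "0 \<le> l * inner v v - inner (f v) v" if "v \<in> W" for v
  proof (cases "v = 0")
    case False
    have "inner (f ((1 / norm v) *\<^sub>R v)) ((1 / norm v) *\<^sub>R v) \<le> l"
      unfolding l_def using that False W by (intro max) (simp add: subspace_scale)
    then have "inner (f v) v / (norm v)\<^sup>2 \<le> l"
      by (simp add: f.scaleR power2_eq_square)
    then show ?thesis
      using False by (simp add: field_simps power2_norm_eq_inner)
  qed (simp add: f.zero)
  have zz: "inner z z = 1" and "z \<in> W"
    using z by (simp_all add: norm_eq_sqrt_inner)
  define y where "y = l *\<^sub>R z - f z"
  have y: "y \<in> W"
    unfolding y_def using W \<open>z \<in> W\<close> by (auto intro: subspace_diff subspace_scale)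
  have "0 \<le> 2 * t * (l * inner z y - inner (f z) y) + t\<^sup>2 * (l * inner y y - inner (f y) y)" for t
  proof -
    have "0 \<le> l * inner (z + t *\<^sub>R y) (z + t *\<^sub>R y) - inner (f (z + t *\<^sub>R y)) (z + t *\<^sub>R y)"
      using y \<open>z \<in> W\<close> W by (intro q) (auto intro: subspace_add subspace_scale)
    also have "\<dots> = (l * inner z z - inner (f z) z)
        + 2 * t * (l * inner z y - inner (f z) y) + t\<^sup>2 * (l * inner y y - inner (f y) y)"
      using sa[of y z]
      by (simp add: f.add f.scaleR inner_simps inner_commute power2_eq_square algebra_simps)
    finally show ?thesis
      by (simp add: zz l_def)
  qed
  then have "l * inner z y - inner (f z) y = 0"
    by (rule linear_coeff_zero)
  then have "inner (l *\<^sub>R z - f z) y = 0"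
    by (simp add: inner_diff_left)
  then have "inner y y = 0"
    by (simp add: y_def)
  then have "f z = l *\<^sub>R z"
    by (simp add: y_def)
  moreover have "z \<noteq> 0"
    using zz by auto
  ultimately show ?thesis
    using that \<open>z \<in> W\<close> by blast
qed

text \<open>Jordan frames without primitivity and without the condition that the sum is
  \<open>junit\<close>; both are recovered below from the maximality of a system.\<close>

definition orthogonal_idempotents :: "'a::jordan_algebra set \<Rightarrow> bool" where
  "orthogonal_idempotents C \<longleftrightarrow> finite C \<and> (\<forall>c\<in>C. c \<noteq> 0 \<and> c \<star> c = c) \<and>
     (\<forall>c\<in>C. \<forall>c'\<in>C. c \<noteq> c' \<longrightarrow> c \<star> c' = 0)"

text \<open>Jordan orthogonality implies orthogonality for \<open>inner\<close>, since
  \<open>inner c c' = inner c (c \<star> c')\<close>. The bound makes systems of largest cardinality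
  exist.\<close>

lemma orthogonal_idempotents_card:
  fixes C :: "'a::euclidean_jordan_algebra set"
  assumes "orthogonal_idempotents C"
  shows "card C \<le> DIM('a)"
proof -
  have "pairwise orthogonal C"
    unfolding pairwise_def orthogonal_def
  proof (intro ballI impI)
    fix c c' assume "c \<in> C" "c' \<in> C" "c \<noteq> c'"
    then have "c \<star> c = c" "c \<star> c' = 0"
      using assms by (auto simp: orthogonal_idempotents_def)
    then show "inner c c' = 0"
      using inner_jprod[of c c c'] by simp
  qed
  moreover have "0 \<notin> C"
    using assms by (auto simp: orthogonal_idempotents_def)
  ultimately have "independent C"
    by (rule pairwise_orthogonal_independent)
  then show ?thesis
    using independent_bound by blast
qed

lemma sum_idempotents_mult:
  assumes "orthogonal_idempotents C" "c \<in> C"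
  shows "(\<Sum>c\<in>C. f c *\<^sub>R c) \<star> c = f c *\<^sub>R c"
proof -
  have "(\<Sum>c\<in>C. f c *\<^sub>R c) \<star> c = (\<Sum>c'\<in>C. if c' = c then f c *\<^sub>R c else 0)"
    unfolding jprod_sum_left using assms
    by (intro sum.cong) (auto simp: jprod_scaleR_left orthogonal_idempotents_def)
  then show ?thesis
    using assms by (simp add: orthogonal_idempotents_def)
qed

lemma sum_idempotents_mult_sum:
  assumes "orthogonal_idempotents C"
  shows "(\<Sum>c\<in>C. f c *\<^sub>R c) \<star> (\<Sum>c\<in>C. g c *\<^sub>R c) = (\<Sum>c\<in>C. (f c * g c) *\<^sub>R c)"
  unfolding jprod_sum_right[of _ "\<lambda>c. g c *\<^sub>R c"]
  by (intro sum.cong refl) (simp add: jprod_scaleR_right sum_idempotents_mult[OF assms])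

text \<open>Take a largest system of idempotents in the power algebra that are eigenvectors of
  \<open>u\<close>. If its sum \<open>S\<close> were not \<open>junit\<close>, the annihilator
  \<open>W\<close> of \<open>S\<close> would contain \<open>junit - S\<close> and be stable under
  \<open>u\<close>; an eigenvector in \<open>W\<close> would then yield one more idempotent.\<close>

lemma idempotent_decomposition:
  fixes u :: "'a::euclidean_jordan_algebra"
  obtains C ev where "orthogonal_idempotents C" "(\<Sum>c\<in>C. c) = junit" "u = (\<Sum>c\<in>C. ev c *\<^sub>R c)"
proof -
  define P where "P C \<longleftrightarrow> orthogonal_idempotents C \<and> C \<subseteq> power_algebra u \<and>
    (\<forall>c\<in>C. \<exists>l. u \<star> c = l *\<^sub>R c)" for C
  have "P {}"
    by (simp add: P_def orthogonal_idempotents_def)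
  moreover have "\<forall>C. P C \<longrightarrow> card C \<le> DIM('a)"
    using orthogonal_idempotents_card by (auto simp: P_def)
  ultimately obtain C where C: "P C" and max: "\<And>C'. P C' \<Longrightarrow> card C' \<le> card C"
    using ex_has_greatest_nat[of P "{}" card "Suc DIM('a)"] by (auto simp: less_Suc_eq_le)
  have oi: "orthogonal_idempotents C" and sub: "C \<subseteq> power_algebra u" and fin: "finite C"
    using C by (auto simp: P_def orthogonal_idempotents_def)
  define S where "S = (\<Sum>c\<in>C. c)"
  have Sc: "S \<star> c = c" if "c \<in> C" for c
    using sum_idempotents_mult[OF oi that, of "\<lambda>_. 1"] by (simp add: S_def)
  have S: "S \<in> power_algebra u"
    unfolding S_def using sub by (auto intro: span_sum)
  have SS: "S \<star> S = S"
    using sum_idempotents_mult_sum[OF oi, of "\<lambda>_. 1" "\<lambda>_. 1"] by (simp add: S_def)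
  have "S = junit"
  proof (rule ccontr)
    assume "S \<noteq> junit"
    define W where "W = {v \<in> power_algebra u. S \<star> v = 0}"
    have "subspace W"
      unfolding W_def by (auto intro!: subspaceI simp: jprod_simps span_add span_scale span_zero)
    moreover have "junit - S \<in> W"
      using S SS by (simp add: W_def span_diff junit_in_power_algebra jprod_simps junit_right)
    moreover have "(\<star>) u ` W \<subseteq> W"
    proof
      fix y assume "y \<in> (\<star>) u ` W"
      then obtain v where v: "v \<in> power_algebra u" "S \<star> v = 0" and y: "y = u \<star> v"
        by (auto simp: W_def)
      have "S \<star> (u \<star> v) = u \<star> (S \<star> v)"
        using power_algebra_assoc[OF S self_in_power_algebra v(1)]
          power_algebra_assoc[OF self_in_power_algebra S v(1)] by (simp add: jprod_commute)
      then show "y \<in> W"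
        using v power_algebra_mult[OF self_in_power_algebra v(1)] by (simp add: y W_def)
    qed
    moreover have "W \<noteq> {0}"
      using \<open>junit - S \<in> W\<close> \<open>S \<noteq> junit\<close> by auto
    ultimately obtain z l where z: "z \<in> W" "z \<noteq> 0" "u \<star> z = l *\<^sub>R z"
      using selfadjoint_eigenvector[OF linear_jprod inner_jprod] by metis
    have zu: "z \<in> power_algebra u" and Sz: "S \<star> z = 0"
      using z by (auto simp: W_def)
    obtain r where r: "z \<star> z = r *\<^sub>R z"
      using power_algebra_eigenvector_mult[OF zu zu z(3)] by blast
    \<comment> \<open>There are no nilpotents: \<open>z \<star> z = 0\<close> would give
      \<open>inner z z = inner junit (z \<star> z) = 0\<close>.\<close>
    have "inner z z = r * inner junit z"
      using inner_jprod[of z junit z] by (simp add: junit_right r)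
    then have "r \<noteq> 0"
      using z by auto
    define c where "c = (1 / r) *\<^sub>R z"
    have c: "c \<noteq> 0" "c \<star> c = c" "u \<star> c = l *\<^sub>R c" "S \<star> c = 0" "c \<in> power_algebra u"
      using z r \<open>r \<noteq> 0\<close> Sz zu by (simp_all add: c_def jprod_simps span_scale)
    have 0: "c \<star> c' = 0" if "c' \<in> C" for c'
      using power_algebra_assoc[OF c(5) S, of c'] that sub Sc c(4)
      by (auto simp: jprod_commute[of c S])
    moreover have "c' \<star> c = 0" if "c' \<in> C" for c'
      using 0[OF that] by (metis jprod_commute)
    moreover have "c \<notin> C"
      using Sc c by auto
    ultimately have "P (insert c C)" "card (insert c C) = Suc (card C)"
      using C c fin by (auto simp: P_def orthogonal_idempotents_def)
    then show False
      using max by fastforce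
  qed
  obtain ev where ev: "\<And>c. c \<in> C \<Longrightarrow> u \<star> c = ev c *\<^sub>R c"
    using C unfolding P_def by metis
  have "u = u \<star> S"
    using \<open>S = junit\<close> by (simp add: junit_right)
  also have "\<dots> = (\<Sum>c\<in>C. ev c *\<^sub>R c)"
    unfolding S_def jprod_sum_right using ev by (intro sum.cong) auto
  finally show ?thesis
    using that[OF oi] \<open>S = junit\<close> unfolding S_def by blast
qed

lemma jordan_frame_orthogonal_idempotents: "jordan_frame C \<Longrightarrow> orthogonal_idempotents C"
  by (auto simp: jordan_frame_def orthogonal_idempotents_def primitive_idempotent_def)

text \<open>Among complete systems diagonalising \<open>u\<close>, one of largest cardinality has
  primitive members: a splitting \<open>c = a + b\<close> would enlarge it, with \<open>a\<close>
  and \<open>b\<close> inheriting the eigenvalue of \<open>c\<close>.\<close>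

theorem spectral_theorem:
  fixes u :: "'a::euclidean_jordan_algebra"
  obtains C ev where "spectral_decomposition u C ev"
proof -
  define P where "P C \<longleftrightarrow> orthogonal_idempotents C \<and> (\<Sum>c\<in>C. c) = junit \<and>
    (\<exists>ev. u = (\<Sum>c\<in>C. ev c *\<^sub>R c))" for C
  obtain C0 where "P C0"
    unfolding P_def using idempotent_decomposition by metis
  moreover have "\<forall>C. P C \<longrightarrow> card C \<le> DIM('a)"
    using orthogonal_idempotents_card by (auto simp: P_def)
  ultimately obtain C where C: "P C" and max: "\<And>C'. P C' \<Longrightarrow> card C' \<le> card C"
    using ex_has_greatest_nat[of P C0 card "Suc DIM('a)"] by (auto simp: less_Suc_eq_le)
  obtain ev where ev: "u = (\<Sum>c\<in>C. ev c *\<^sub>R c)"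
    using C by (auto simp: P_def)
  have oi: "orthogonal_idempotents C" and fin: "finite C"
    using C by (auto simp: P_def orthogonal_idempotents_def)
  have "primitive_idempotent c" if c: "c \<in> C" for c
  proof (rule ccontr)
    assume "\<not> primitive_idempotent c"
    moreover have cc: "c \<star> c = c" "c \<noteq> 0"
      using oi c by (auto simp: orthogonal_idempotents_def)
    ultimately obtain a b where ab: "a \<noteq> 0" "b \<noteq> 0" "a \<star> a = a" "b \<star> b = b" "a \<star> b = 0"
      and cab: "c = a + b"
      by (auto simp: primitive_idempotent_def)
    define D where "D = C - {c}"
    have ac: "a \<star> c = a" and bc: "b \<star> c = b"
      using ab by (simp_all add: cab jprod_add_right jprod_commute[of b a])
    have orth: "a \<star> c' = 0" "b \<star> c' = 0" if "c' \<in> D" for c'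
      using that c oi cc ac bc split_idempotent_orthogonal[of c c']
      by (auto simp: D_def orthogonal_idempotents_def)
    moreover have "c' \<star> a = 0" "c' \<star> b = 0" if "c' \<in> D" for c'
      using orth[OF that] by (metis jprod_commute)+
    moreover have "b \<star> a = 0"
      using ab by (metis jprod_commute)
    ultimately have orth': "orthogonal_idempotents (insert a (insert b (C - {c})))"
      using oi ab by (auto simp: orthogonal_idempotents_def D_def)
    have "a \<noteq> b"
      using ab by auto
    have nin: "a \<notin> D" "b \<notin> D"
      using orth ab by metis+
    have finD: "finite D"
      using fin by (simp add: D_def)
    have CD: "C = insert c D" "c \<notin> D"
      using c by (auto simp: D_def)
    have "orthogonal_idempotents (insert a (insert b D))"
      using orth' by (simp add: D_def)
    moreover have "(\<Sum>c\<in>insert a (insert b D). c) = junit"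
      using C finD nin \<open>a \<noteq> b\<close> CD by (simp add: P_def cab add.assoc)
    moreover have "u = (\<Sum>c'\<in>insert a (insert b D). (if c' \<in> D then ev c' else ev c) *\<^sub>R c')"
      using ev finD nin \<open>a \<noteq> b\<close> CD by (simp add: cab scaleR_right_distrib add.assoc)
    ultimately have "P (insert a (insert b D))"
      unfolding P_def by (intro conjI exI[where x = "\<lambda>c'. if c' \<in> D then ev c' else ev c"])
    then have "card (insert a (insert b D)) \<le> card C"
      by (rule max)
    then show False
      using finD nin \<open>a \<noteq> b\<close> CD by simp
  qed
  then have "spectral_decomposition u C ev"
    using C ev fin oi
    by (simp add: spectral_decomposition_def jordan_frame_def P_def orthogonal_idempotents_def)
  then show ?thesis
    by (rule that)
qed

section \<open>Functional calculus\<close>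

lemma interpolating_polynomial:
  fixes f :: "real \<Rightarrow> real"
  assumes "finite S"
  shows "\<exists>p. \<forall>x\<in>S. poly p x = f x"
  using assms
proof (induction S)
  case (insert a S)
  then obtain p where p: "\<forall>x\<in>S. poly p x = f x" by auto
  define q where "q = (\<Prod>x\<in>S. [:- x, 1:])"
  have q: "poly q x = 0 \<longleftrightarrow> x \<in> S" for x
    using insert by (auto simp: q_def poly_prod)
  have "\<forall>x\<in>insert a S. poly (p + smult ((f a - poly p a) / poly q a) q) x = f x"
    using p q insert by auto
  then show ?case by blast
qed simp

lemma jpower_sum_idempotents:
  assumes "orthogonal_idempotents C" "(\<Sum>c\<in>C. c) = junit"
  shows "jpower (\<Sum>c\<in>C. ev c *\<^sub>R c) k = (\<Sum>c\<in>C. (ev c ^ k) *\<^sub>R c)"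
  by (induction k) (simp_all add: assms sum_idempotents_mult_sum)

lemma polynomial_sum_idempotents:
  assumes "orthogonal_idempotents C" "(\<Sum>c\<in>C. c) = junit"
  shows "(\<Sum>i\<le>degree p. coeff p i *\<^sub>R jpower (\<Sum>c\<in>C. ev c *\<^sub>R c) i)
    = (\<Sum>c\<in>C. poly p (ev c) *\<^sub>R c)"
  unfolding jpower_sum_idempotents[OF assms] poly_altdef scaleR_sum_left scaleR_sum_right
  by (subst sum.swap) simp

text \<open>One polynomial interpolates \<open>f\<close> on the eigenvalues of both decompositions,
  and a polynomial in \<open>u\<close> does not refer to any decomposition.\<close>

lemma spectral_map_eq:
  fixes u :: "'a::euclidean_jordan_algebra"
  assumes "spectral_decomposition u C ev"
  shows "spectral_map f u = (\<Sum>c\<in>C. f (ev c) *\<^sub>R c)"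
  unfolding spectral_map_def
proof (rule the_equality)
  show "\<exists>C' ev'. spectral_decomposition u C' ev' \<and>
      (\<Sum>c\<in>C. f (ev c) *\<^sub>R c) = (\<Sum>c\<in>C'. f (ev' c) *\<^sub>R c)"
    using assms by blast
next
  fix y assume "\<exists>C' ev'. spectral_decomposition u C' ev' \<and> y = (\<Sum>c\<in>C'. f (ev' c) *\<^sub>R c)"
  then obtain C' ev' where C': "spectral_decomposition u C' ev'"
    and y: "y = (\<Sum>c\<in>C'. f (ev' c) *\<^sub>R c)"
    by blast
  have "finite (ev ` C \<union> ev' ` C')"
    using assms C' by (simp add: spectral_decomposition_def jordan_frame_def)
  then obtain p where p: "\<forall>x\<in>ev ` C \<union> ev' ` C'. poly p x = f x"
    using interpolating_polynomial by blast
  have *: "(\<Sum>i\<le>degree p. coeff p i *\<^sub>R jpower u i) = (\<Sum>c\<in>D. poly p (e c) *\<^sub>R c)"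
    if "spectral_decomposition u D e" for D e
    using that polynomial_sum_idempotents[of D p e] jordan_frame_orthogonal_idempotents[of D]
    by (simp add: spectral_decomposition_def jordan_frame_def)
  have "(\<Sum>c\<in>C'. poly p (ev' c) *\<^sub>R c) = (\<Sum>c\<in>C. poly p (ev c) *\<^sub>R c)"
    using *[OF assms] *[OF C'] by simp
  then show "y = (\<Sum>c\<in>C. f (ev c) *\<^sub>R c)"
    using p y by simp
qed

section \<open>The quadratic representation\<close>

lemma bounded_bilinear_jprod:
  "bounded_bilinear ((\<star>) :: 'a::euclidean_jordan_algebra \<Rightarrow> 'a \<Rightarrow> 'a)"
proof -
  have "bilinear ((\<star>) :: 'a \<Rightarrow> 'a \<Rightarrow> 'a)"
    unfolding bilinear_def by (auto intro!: linearI simp: jprod_simps)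
  then show ?thesis
    by (simp add: bilinear_conv_bounded_bilinear)
qed

lemmas has_vector_derivative_jprod =
  bounded_bilinear.has_vector_derivative[OF bounded_bilinear_jprod]

lemma quad_selfadjoint: "inner (quad a u) v = inner u (quad a v)"
  by (simp add: quad_def inner_simps inner_jprod)

lemma linear_quad: "linear (quad a)"
  by (rule linearI) (simp_all add: quad_def jprod_simps algebra_simps)

lemmas quad_add_right = linear_add[OF linear_quad]
  and quad_scaleR_right = linear_cmul[OF linear_quad]
  and quad_minus_right = linear_neg[OF linear_quad]
  and quad_diff_right = linear_diff[OF linear_quad]
  and quad_zero_right = linear_0[OF linear_quad]

lemma quad_scaleR_left: "quad (r *\<^sub>R a) v = (r * r) *\<^sub>R quad a v"
  by (simp add: quad_def jprod_simps scaleR_right_diff_distrib mult.commute mult.left_commute)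

lemma quad_junit_right: "quad a junit = a \<star> a"
  by (simp add: quad_def junit_right scaleR_2)

lemma quad_junit_left: "quad junit v = v"
  by (simp add: quad_def junit_left scaleR_2)

lemma quad_polar_scaleR_left: "quad_polar (r *\<^sub>R a) b v = r *\<^sub>R quad_polar a b v"
  by (simp add: quad_polar_def jprod_simps algebra_simps)

lemma has_vector_derivative_quad:
  assumes "(a has_vector_derivative a') (at t within S)"
    and "(v has_vector_derivative v') (at t within S)"
  shows "((\<lambda>s. quad (a s) (v s)) has_vector_derivative
    2 *\<^sub>R quad_polar a' (a t) (v t) + quad (a t) v') (at t within S)"
proof -
  have "((\<lambda>s. 2 *\<^sub>R (a s \<star> (a s \<star> v s)) - (a s \<star> a s) \<star> v s) has_vector_derivative
      2 *\<^sub>R (a t \<star> (a t \<star> v' + a' \<star> v t) + a' \<star> (a t \<star> v t))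
      - ((a t \<star> a t) \<star> v' + (a t \<star> a' + a' \<star> a t) \<star> v t)) (at t within S)"
    by (intro has_vector_derivative_diff has_vector_derivative_jprod assms
        bounded_linear.has_vector_derivative[OF bounded_linear_scaleR_right])
  then show ?thesis
    unfolding quad_def quad_polar_def
    by (simp add: jprod_simps scaleR_2 jprod_commute[of "a t" a'] algebra_simps)
qed

lemma idempotent_sums_commute:
  assumes "orthogonal_idempotents C"
  shows "(\<Sum>c\<in>C. f c *\<^sub>R c) \<star> ((\<Sum>c\<in>C. g c *\<^sub>R c) \<star> v)
    = (\<Sum>c\<in>C. g c *\<^sub>R c) \<star> ((\<Sum>c\<in>C. f c *\<^sub>R c) \<star> v)"
proof -
  have *: "c \<star> (c' \<star> v) = c' \<star> (c \<star> v)" if "c \<in> C" "c' \<in> C" for c c'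
    using that assms orthogonal_idempotents_commute[of c c' v]
    by (cases "c = c'") (auto simp: orthogonal_idempotents_def)
  show ?thesis
    unfolding jprod_sum_left jprod_sum_right jprod_scaleR_left jprod_scaleR_right
      scaleR_sum_right scaleR_scaleR
    by (subst sum.swap) (auto simp: * mult.commute intro!: sum.cong)
qed

lemma idempotent_sum_quad_commute:
  assumes "orthogonal_idempotents C"
  shows "(\<Sum>c\<in>C. f c *\<^sub>R c) \<star> quad (\<Sum>c\<in>C. g c *\<^sub>R c) v
    = quad (\<Sum>c\<in>C. g c *\<^sub>R c) ((\<Sum>c\<in>C. f c *\<^sub>R c) \<star> v)"
  unfolding quad_def sum_idempotents_mult_sum[OF assms]
  by (simp add: jprod_simps idempotent_sums_commute[OF assms, of f])

lemma quad_sum_idempotents: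
  assumes "orthogonal_idempotents C"
  shows "quad (\<Sum>c\<in>C. f c *\<^sub>R c) (\<Sum>c\<in>C. g c *\<^sub>R c) = (\<Sum>c\<in>C. (f c * f c * g c) *\<^sub>R c)"
  unfolding quad_def sum_idempotents_mult_sum[OF assms]
  by (simp add: scaleR_2 mult.assoc)

text \<open>The curve \<open>exp (t x)\<close>, where \<open>x\<close> has eigenvalues
  \<open>l\<close> on the frame \<open>C\<close>. With the frame explicit, square root and inverse
  become the changes of \<open>t\<close> into \<open>t / 2\<close> and \<open>- t\<close>.\<close>

definition frame_exp :: "'a set \<Rightarrow> ('a \<Rightarrow> real) \<Rightarrow> real \<Rightarrow> 'a::euclidean_jordan_algebra" where
  "frame_exp C l t = (\<Sum>c\<in>C. exp (t * l c) *\<^sub>R c)"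

lemma frame_exp_0: "jordan_frame C \<Longrightarrow> frame_exp C l 0 = junit"
  by (simp add: frame_exp_def jordan_frame_def)

lemma has_vector_derivative_frame_exp:
  assumes "jordan_frame C" and k: "(k has_real_derivative k') (at t within S)"
  shows "((\<lambda>s. frame_exp C l (k s)) has_vector_derivative
    k' *\<^sub>R ((\<Sum>c\<in>C. l c *\<^sub>R c) \<star> frame_exp C l (k t))) (at t within S)"
proof -
  have "((\<lambda>s. exp (k s * l c) *\<^sub>R c) has_vector_derivative
      (k' * (l c * exp (k t * l c))) *\<^sub>R c) (at t within S)" for c
  proof -
    have "((\<lambda>s. exp (k s * l c)) has_real_derivative k' * (l c * exp (k t * l c))) (at t within S)"
      by (rule derivative_eq_intros refl k)+ simp
    then show ?thesis
      by (rule has_vector_derivative_scaleR[OF _ has_vector_derivative_const, THEN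
            has_vector_derivative_eq_rhs]) simp
  qed
  then have "((\<lambda>s. \<Sum>c\<in>C. exp (k s * l c) *\<^sub>R c) has_vector_derivative
      (\<Sum>c\<in>C. (k' * (l c * exp (k t * l c))) *\<^sub>R c)) (at t within S)"
    by (intro has_vector_derivative_sum)
  then show ?thesis
    using assms(1)[THEN jordan_frame_orthogonal_idempotents]
    by (simp add: frame_exp_def sum_idempotents_mult_sum scaleR_sum_right)
qed

text \<open>By \<open>jprod_quad_polar\<close> the operator \<open>quad (frame_exp C l t)\<close>
  differentiates to \<open>x\<close> times it plus it times \<open>x\<close>; the two agree because
  all multiplications by elements of one frame commute. The inner function \<open>k\<close> covers
  the times \<open>s\<close>, \<open>- s\<close> and \<open>- (r + t)\<close> needed below.\<close>

lemma has_vector_derivative_quad_frame_exp: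
  assumes C: "jordan_frame C" and k: "(k has_real_derivative k') (at t within S)"
    and v: "(v has_vector_derivative v') (at t within S)"
  shows "((\<lambda>s. quad (frame_exp C l (k s)) (v s)) has_vector_derivative
    (2 * k') *\<^sub>R ((\<Sum>c\<in>C. l c *\<^sub>R c) \<star> quad (frame_exp C l (k t)) (v t))
    + quad (frame_exp C l (k t)) v') (at t within S)"
proof -
  let ?x = "\<Sum>c\<in>C. l c *\<^sub>R c" and ?a = "frame_exp C l (k t)"
  have "2 *\<^sub>R quad_polar (k' *\<^sub>R (?x \<star> ?a)) ?a (v t)
      = k' *\<^sub>R (?x \<star> quad ?a (v t) + quad ?a (?x \<star> v t))"
    by (simp add: quad_polar_scaleR_left jprod_quad_polar)
  also have "\<dots> = (2 * k') *\<^sub>R (?x \<star> quad ?a (v t))"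
    using idempotent_sum_quad_commute[OF C[THEN jordan_frame_orthogonal_idempotents]]
    by (simp add: frame_exp_def flip: scaleR_2)
  finally show ?thesis
    using has_vector_derivative_quad[OF has_vector_derivative_frame_exp[OF C k, of l] v] by simp
qed

lemma derivative_zero_imp_eq:
  fixes F :: "real \<Rightarrow> 'a::real_normed_vector"
  assumes "\<And>s. (F has_vector_derivative 0) (at s)"
  shows "F s = F t"
proof -
  obtain c where "\<And>s. F s = c"
    using has_vector_derivative_zero_constant[of UNIV F] assms by auto
  then show ?thesis by simp
qed

lemma quad_frame_exp_commute:
  assumes "jordan_frame C"
  shows "(\<Sum>c\<in>C. l c *\<^sub>R c) \<star> quad (frame_exp C l t) v
    = quad (frame_exp C l t) ((\<Sum>c\<in>C. l c *\<^sub>R c) \<star> v)"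
  unfolding frame_exp_def
  by (rule idempotent_sum_quad_commute[OF assms[THEN jordan_frame_orthogonal_idempotents]])

text \<open>The generators at times \<open>s\<close> and \<open>- s\<close> cancel, so the composite
  is constant in \<open>s\<close> and equals its value at 0.\<close>

lemma quad_frame_exp_inverse:
  assumes C: "jordan_frame C"
  shows "quad (frame_exp C l t) (quad (frame_exp C l (- t)) v) = v"
proof -
  define F where "F s = quad (frame_exp C l s) (quad (frame_exp C l (- s)) v)" for s
  have "(F has_vector_derivative 0) (at s)" for s
  proof -
    have k: "((\<lambda>s. s) has_real_derivative 1) (at s)" "(uminus has_real_derivative - 1) (at s)"
      by (auto intro!: derivative_eq_intros)
    show ?thesis
      using has_vector_derivative_quad_frame_exp[OF C k(1)
          has_vector_derivative_quad_frame_exp[OF C k(2) has_vector_derivative_const, of l v], of l]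
      by (simp add: F_def[abs_def] quad_zero_right quad_minus_right quad_scaleR_right
          quad_frame_exp_commute[OF C])
  qed
  then have "F t = F 0"
    by (rule derivative_zero_imp_eq)
  then show ?thesis
    by (simp add: F_def frame_exp_0[OF C] quad_junit_left)
qed

text \<open>Transporting the right-hand side \<open>w\<close> back by the time
  \<open>- (r + t)\<close> makes \<open>F\<close> constant: it is \<open>w\<close> at
  \<open>r = 0\<close> and the left-hand side at \<open>r = s\<close>.\<close>

lemma quad_frame_exp_add:
  assumes C: "jordan_frame C"
  shows "quad (frame_exp C l s) (quad (frame_exp C l t) v) = quad (frame_exp C l (s + t)) v"
proof -
  define w where "w = quad (frame_exp C l (s + t)) v"
  define F where "F r = quad (frame_exp C l r) (quad (frame_exp C l t) (quad (frame_exp C l (- (r + t))) w))"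
    for r
  have "(F has_vector_derivative 0) (at r)" for r
  proof -
    have k: "((\<lambda>r. r) has_real_derivative 1) (at r)" "((\<lambda>r. t) has_real_derivative 0) (at r)"
      "((\<lambda>r. - (r + t)) has_real_derivative - 1) (at r)"
      by (auto intro!: derivative_eq_intros)
    show ?thesis
      using has_vector_derivative_quad_frame_exp[OF C k(1)
          has_vector_derivative_quad_frame_exp[OF C k(2)
          has_vector_derivative_quad_frame_exp[OF C k(3) has_vector_derivative_const, of l w], of l],
          of l]
      by (simp add: F_def[abs_def] quad_zero_right quad_minus_right quad_scaleR_right
          quad_frame_exp_commute[OF C])
  qed
  then have "F s = F 0"
    by (rule derivative_zero_imp_eq)
  moreover have "F 0 = w"
    by (simp add: F_def frame_exp_0[OF C] quad_junit_left quad_frame_exp_inverse[OF C])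
  moreover have "F s = quad (frame_exp C l s) (quad (frame_exp C l t) v)"
    using quad_frame_exp_inverse[OF C, of l "- (s + t)" v] by (simp add: F_def w_def algebra_simps)
  ultimately show ?thesis
    by (simp add: w_def)
qed

text \<open>By \<open>jprod_quad_polar\<close>, \<open>2 x \<star> _\<close> is an infinitesimal automorphism of \<open>quad\<close>, so its flow
  \<open>quad (frame_exp C l t)\<close> preserves \<open>quad\<close>.\<close>

lemma quad_quad_frame_exp:
  assumes C: "jordan_frame C"
  shows "quad (quad (frame_exp C l t) y) z
    = quad (frame_exp C l t) (quad y (quad (frame_exp C l t) z))"
proof -
  let ?x = "\<Sum>c\<in>C. l c *\<^sub>R c"
  \<comment> \<open>\<open>F\<close> pulls the moving operator \<open>quad (Y s)\<close> back by the
    flow, and \<open>w\<close> is chosen so that \<open>W t = z\<close>.\<close>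
  define Y where "Y s = quad (frame_exp C l s) y" for s
  define w where "w = quad (frame_exp C l t) z"
  define W where "W s = quad (frame_exp C l (- s)) w" for s
  define F where "F s = quad (frame_exp C l (- s)) (quad (Y s) (W s))" for s
  have "(F has_vector_derivative 0) (at s)" for s
  proof -
    have k: "((\<lambda>s. s) has_real_derivative 1) (at s)" "(uminus has_real_derivative - 1) (at s)"
      by (auto intro!: derivative_eq_intros)
    have Y: "(Y has_vector_derivative 2 *\<^sub>R (?x \<star> Y s)) (at s)"
      using has_vector_derivative_quad_frame_exp[OF C k(1) has_vector_derivative_const, of l y]
      by (simp add: Y_def[abs_def] quad_zero_right)
    have W: "(W has_vector_derivative - (2 *\<^sub>R (?x \<star> W s))) (at s)"
      using has_vector_derivative_quad_frame_exp[OF C k(2) has_vector_derivative_const, of l w]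
      by (simp add: W_def[abs_def] quad_zero_right)
    have "((\<lambda>s. quad (Y s) (W s)) has_vector_derivative 2 *\<^sub>R (?x \<star> quad (Y s) (W s))) (at s)"
      using has_vector_derivative_quad[OF Y W]
      by (rule has_vector_derivative_eq_rhs)
        (simp add: quad_polar_scaleR_left quad_minus_right quad_scaleR_right algebra_simps
          flip: jprod_quad_polar)
    from has_vector_derivative_quad_frame_exp[OF C k(2) this, of l] show ?thesis
      by (simp add: F_def[abs_def] quad_scaleR_right quad_frame_exp_commute[OF C])
  qed
  then have "F t = F 0"
    by (rule derivative_zero_imp_eq)
  moreover have "F 0 = quad y (quad (frame_exp C l t) z)"
    by (simp add: F_def Y_def W_def w_def frame_exp_0[OF C] quad_junit_left)
  moreover have "W t = z"
    using quad_frame_exp_inverse[OF C, of l "- t" z] by (simp add: W_def w_def)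
  ultimately have "quad (frame_exp C l (- t)) (quad (Y t) z) = quad y (quad (frame_exp C l t) z)"
    by (simp add: F_def)
  then show ?thesis
    using quad_frame_exp_inverse[OF C] by (metis Y_def)
qed

section \<open>The cone of squares\<close>

lemma inner_sum_idempotents:
  "inner ((\<Sum>c\<in>C. f c *\<^sub>R c) \<star> v) v = (\<Sum>c\<in>C. f c * inner (c \<star> v) v)"
  by (simp add: jprod_sum_left inner_sum_left jprod_scaleR_left)

text \<open>Unlike the existential definition, the right-hand side is a family of linear
  inequalities in \<open>y\<close>, which makes closedness and convexity immediate. Testing with a
  member \<open>c\<close> of the frame reads off the sign of its eigenvalue.\<close>

lemma cone_of_squares_iff: "y \<in> cone_of_squares \<longleftrightarrow> (\<forall>v. 0 \<le> inner (y \<star> v) v)"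
proof
  assume "y \<in> cone_of_squares"
  then obtain u where u: "y = u \<star> u"
    by (auto simp: cone_of_squares_def)
  obtain C ev where "spectral_decomposition u C ev"
    by (rule spectral_theorem)
  then have C: "orthogonal_idempotents C" "u = (\<Sum>c\<in>C. ev c *\<^sub>R c)"
    by (auto simp: spectral_decomposition_def jordan_frame_orthogonal_idempotents)
  then have "y = (\<Sum>c\<in>C. (ev c * ev c) *\<^sub>R c)"
    by (simp add: u sum_idempotents_mult_sum)
  then show "\<forall>v. 0 \<le> inner (y \<star> v) v"
    using C by (auto simp: inner_sum_idempotents orthogonal_idempotents_def idempotent_psd
        intro!: sum_nonneg)
next
  assume psd: "\<forall>v. 0 \<le> inner (y \<star> v) v"
  obtain C ev where "spectral_decomposition y C ev"
    by (rule spectral_theorem)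
  then have C: "orthogonal_idempotents C" and y: "y = (\<Sum>c\<in>C. ev c *\<^sub>R c)"
    by (auto simp: spectral_decomposition_def jordan_frame_orthogonal_idempotents)
  have "0 \<le> ev c" if "c \<in> C" for c
  proof -
    have "0 \<le> ev c * inner c c"
      using psd[rule_format, of c] sum_idempotents_mult[OF C that, of ev] by (simp add: y)
    moreover have "0 < inner c c"
      using C that by (auto simp: orthogonal_idempotents_def)
    ultimately show ?thesis
      by (simp add: zero_le_mult_iff)
  qed
  then have "y = (\<Sum>c\<in>C. sqrt (ev c) *\<^sub>R c) \<star> (\<Sum>c\<in>C. sqrt (ev c) *\<^sub>R c)"
    unfolding sum_idempotents_mult_sum[OF C] y by (intro sum.cong) auto
  then show "y \<in> cone_of_squares"
    by (auto simp: cone_of_squares_def)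
qed

lemma closed_cone_of_squares: "closed (cone_of_squares :: 'a::euclidean_jordan_algebra set)"
proof -
  have eq: "cone_of_squares = (\<Inter>v. {y :: 'a. 0 \<le> inner (y \<star> v) v})"
    by (auto simp: cone_of_squares_iff)
  have "closed {y :: 'a. 0 \<le> inner (y \<star> v) v}" for v
    by (intro closed_Collect_le continuous_intros
        bounded_linear.continuous_on[OF bounded_bilinear.bounded_linear_left[OF bounded_bilinear_jprod]])
  then show ?thesis
    unfolding eq by (intro closed_INT ballI)
qed

lemma convex_cone_of_squares: "convex (cone_of_squares :: 'a::euclidean_jordan_algebra set)"
  by (auto simp: convex_def cone_of_squares_iff jprod_simps inner_simps)

text \<open>For small \<open>k > 0\<close> the element \<open>u - k *\<^sub>R junit\<close> is still
  a square \<open>y \<star> y\<close>; a frame of \<open>y\<close> diagonalises \<open>u\<close>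
  with eigenvalues at least \<open>k\<close>.\<close>

lemma interior_cone_of_squares_eigenvalues:
  assumes "u \<in> interior cone_of_squares"
  obtains C ev where "spectral_decomposition u C ev" "\<And>c. c \<in> C \<Longrightarrow> 0 < ev c"
proof -
  obtain e where e: "e > 0" "ball u e \<subseteq> cone_of_squares"
    using assms by (auto simp: mem_interior)
  define k where "k = e / (norm (junit :: 'a) + 1)"
  have k: "k > 0"
    using e by (simp add: k_def add_nonneg_pos)
  have "norm (k *\<^sub>R (junit :: 'a)) < e"
    using e by (simp add: k_def pos_divide_less_eq add_nonneg_pos distrib_left)
  then have "u - k *\<^sub>R junit \<in> cone_of_squares"
    using e by (intro subsetD[OF e(2)]) (simp add: dist_norm)
  then obtain y where y: "u - k *\<^sub>R junit = y \<star> y"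
    by (auto simp: cone_of_squares_def)
  obtain C ev where "spectral_decomposition y C ev"
    by (rule spectral_theorem)
  then have C: "jordan_frame C" and yC: "y = (\<Sum>c\<in>C. ev c *\<^sub>R c)"
    by (simp_all add: spectral_decomposition_def)
  have "u = y \<star> y + k *\<^sub>R junit"
    by (simp flip: y)
  also have "\<dots> = (\<Sum>c\<in>C. (ev c * ev c) *\<^sub>R c) + k *\<^sub>R (\<Sum>c\<in>C. c)"
    using C unfolding yC
    by (simp add: sum_idempotents_mult_sum[OF jordan_frame_orthogonal_idempotents[OF C]]
        jordan_frame_def)
  also have "\<dots> = (\<Sum>c\<in>C. (ev c * ev c + k) *\<^sub>R c)"
    by (simp add: scaleR_sum_right scaleR_left_distrib sum.distrib)
  finally have "spectral_decomposition u C (\<lambda>c. ev c * ev c + k)"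
    using C by (simp add: spectral_decomposition_def)
  from that[OF this] show ?thesis
    using k by (simp add: add_nonneg_pos)
qed

text \<open>The form of \<open>u\<close> is bounded below by \<open>m * inner v v\<close>. A
  perturbation of norm below \<open>m / K\<close>, with \<open>K\<close> a bound of the product,
  changes the form by at most that amount.\<close>

lemma eigenvalues_imp_interior_cone_of_squares:
  fixes u :: "'a::euclidean_jordan_algebra"
  assumes "spectral_decomposition u C ev" and pos: "\<And>c. c \<in> C \<Longrightarrow> 0 < ev c"
  shows "u \<in> interior cone_of_squares"
proof -
  have C: "orthogonal_idempotents C" "(\<Sum>c\<in>C. c) = junit" and u: "u = (\<Sum>c\<in>C. ev c *\<^sub>R c)"
    using assms(1)
    by (auto simp: spectral_decomposition_def jordan_frame_orthogonal_idempotents jordan_frame_def)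
  \<comment> \<open>The element 1 makes the set nonempty without a separate argument about
    \<open>C\<close>.\<close>
  define m where "m = Min (insert 1 (ev ` C))"
  have fin: "finite (insert 1 (ev ` C))"
    using C by (simp add: orthogonal_idempotents_def)
  have m: "m > 0" "\<And>c. c \<in> C \<Longrightarrow> m \<le> ev c"
    using pos fin unfolding m_def by (auto intro: Min_le)
  have lower: "m * inner v v \<le> inner (u \<star> v) v" for v
  proof -
    have "m * inner v v = m * inner ((\<Sum>c\<in>C. 1 *\<^sub>R c) \<star> v) v"
      using C by (simp add: junit_left)
    also have "\<dots> = (\<Sum>c\<in>C. m * inner (c \<star> v) v)"
      unfolding inner_sum_idempotents by (simp add: sum_distrib_left)
    also have "\<dots> \<le> (\<Sum>c\<in>C. ev c * inner (c \<star> v) v)"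
      using C m by (intro sum_mono mult_right_mono idempotent_psd)
        (auto simp: orthogonal_idempotents_def)
    finally show ?thesis
      by (simp add: u inner_sum_idempotents)
  qed
  obtain K where K: "K > 0" "\<And>a b :: 'a. norm (a \<star> b) \<le> norm a * norm b * K"
    using bounded_bilinear.pos_bounded[OF bounded_bilinear_jprod] by blast
  have "y \<in> cone_of_squares" if y: "y \<in> ball u (m / K)" for y
    unfolding cone_of_squares_iff
  proof
    fix v
    have "\<bar>inner ((u - y) \<star> v) v\<bar> \<le> norm ((u - y) \<star> v) * norm v"
      by (rule Cauchy_Schwarz_ineq2)
    also have "\<dots> \<le> (norm (u - y) * norm v * K) * norm v"
      by (intro mult_right_mono K) simp
    also have "\<dots> = (norm (u - y) * K) * inner v v"
      by (simp add: dot_square_norm power2_eq_square)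
    also have "\<dots> \<le> m * inner v v"
      using y K by (intro mult_right_mono) (auto simp: dist_norm field_simps)
    finally have "\<bar>inner ((u - y) \<star> v) v\<bar> \<le> m * inner v v" .
    with lower[of v] show "0 \<le> inner (y \<star> v) v"
      by (simp add: jprod_diff_left inner_diff_left)
  qed
  then show ?thesis
    using m K by (auto simp: mem_interior intro!: exI[of _ "m / K"])
qed

lemma frame_exp_spectral_decomposition:
  "jordan_frame C \<Longrightarrow> spectral_decomposition (frame_exp C l t) C (\<lambda>c. exp (t * l c))"
  by (simp add: spectral_decomposition_def frame_exp_def)

lemma frame_exp_in_interior: "jordan_frame C \<Longrightarrow> frame_exp C l t \<in> interior cone_of_squares"
  by (rule eigenvalues_imp_interior_cone_of_squares[OF frame_exp_spectral_decomposition]) auto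

lemma interior_eq_frame_exp:
  assumes "u \<in> interior cone_of_squares"
  obtains C l where "jordan_frame C" "u = frame_exp C l 1"
proof -
  obtain C ev where C: "spectral_decomposition u C ev" and pos: "\<And>c. c \<in> C \<Longrightarrow> 0 < ev c"
    using interior_cone_of_squares_eigenvalues[OF assms] by blast
  have "u = frame_exp C (\<lambda>c. ln (ev c)) 1"
    using C pos by (simp add: frame_exp_def spectral_decomposition_def)
  then show ?thesis
    using C that unfolding spectral_decomposition_def by blast
qed

lemma junit_in_interior: "junit \<in> interior (cone_of_squares :: 'a::euclidean_jordan_algebra set)"
proof -
  obtain C and ev :: "'a \<Rightarrow> real" where "spectral_decomposition junit C ev"
    by (rule spectral_theorem)
  then have C: "jordan_frame C" by (simp add: spectral_decomposition_def)
  then show ?thesis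
    using frame_exp_in_interior[of C ev 0] by (simp add: frame_exp_0)
qed

lemma spectral_map_frame_exp:
  "jordan_frame C \<Longrightarrow> spectral_map f (frame_exp C l t) = (\<Sum>c\<in>C. f (exp (t * l c)) *\<^sub>R c)"
  by (rule spectral_map_eq[OF frame_exp_spectral_decomposition])

lemma sqrt_exp: "sqrt (exp x) = exp (x / 2)"
  by (rule real_sqrt_unique) (simp_all add: power2_eq_square flip: exp_add)

lemma jsqrt_frame_exp: "jordan_frame C \<Longrightarrow> jsqrt (frame_exp C l t) = frame_exp C l (t / 2)"
  unfolding jsqrt_def by (subst spectral_map_frame_exp) (simp_all add: frame_exp_def sqrt_exp)

lemma jinverse_frame_exp: "jordan_frame C \<Longrightarrow> jinverse (frame_exp C l t) = frame_exp C l (- t)"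
  unfolding jinverse_def
  by (subst spectral_map_frame_exp) (simp_all add: frame_exp_def exp_minus)

lemma jinvsqrt_frame_exp:
  "jordan_frame C \<Longrightarrow> jinvsqrt (frame_exp C l t) = frame_exp C l (- (t / 2))"
  unfolding jinvsqrt_def
  by (subst spectral_map_frame_exp) (simp_all add: frame_exp_def sqrt_exp exp_minus)

section \<open>Square roots, inverses and the fundamental formula on the open cone\<close>

context
  fixes p :: "'a::euclidean_jordan_algebra"
  assumes p: "p \<in> interior cone_of_squares"
begin

lemma jsqrt_in_interior: "jsqrt p \<in> interior cone_of_squares"
  using interior_eq_frame_exp[OF p] frame_exp_in_interior jsqrt_frame_exp by metis

lemma jinverse_in_interior: "jinverse p \<in> interior cone_of_squares"
  using interior_eq_frame_exp[OF p] frame_exp_in_interior jinverse_frame_exp by metis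

lemma jinvsqrt_in_interior: "jinvsqrt p \<in> interior cone_of_squares"
  using interior_eq_frame_exp[OF p] frame_exp_in_interior jinvsqrt_frame_exp by metis

lemma quad_quad_jinverse: "quad p (quad (jinverse p) v) = v"
  using interior_eq_frame_exp[OF p] quad_frame_exp_inverse jinverse_frame_exp by metis

lemma quad_jinverse_quad: "quad (jinverse p) (quad p v) = v"
  using interior_eq_frame_exp[OF p] quad_frame_exp_inverse[of _ _ "- 1"] jinverse_frame_exp
  by (metis minus_minus)

lemma jinverse_eq_quad: "jinverse p = quad (jinverse p) p"
proof -
  obtain C l where C: "jordan_frame C" and "p = frame_exp C l 1"
    by (rule interior_eq_frame_exp[OF p])
  then show ?thesis
    unfolding \<open>p = _\<close> jinverse_frame_exp[OF C]
    by (simp add: frame_exp_def exp_minus mult.assoc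
        quad_sum_idempotents[OF C[THEN jordan_frame_orthogonal_idempotents]])
qed

lemma jprod_jinverse: "p \<star> jinverse p = junit"
proof -
  obtain C l where C: "jordan_frame C" and "p = frame_exp C l 1"
    by (rule interior_eq_frame_exp[OF p])
  then show ?thesis
    unfolding \<open>p = _\<close> jinverse_frame_exp[OF C] using C
    by (simp add: frame_exp_def exp_minus jordan_frame_def
        sum_idempotents_mult_sum[OF C[THEN jordan_frame_orthogonal_idempotents]])
qed

text \<open>The operator alone determines the inverse: a right inverse \<open>T\<close> of
  \<open>quad p\<close> must be \<open>quad (jinverse p)\<close>, and this maps \<open>p\<close> to
  \<open>jinverse p\<close>.\<close>

lemma jinverse_unique:
  assumes "\<And>v. quad p (T v) = v"
  shows "jinverse p = T p"
  using assms quad_jinverse_quad jinverse_eq_quad by metis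

lemma quad_jinvsqrt_jinvsqrt: "quad (jinvsqrt p) (quad (jinvsqrt p) v) = quad (jinverse p) v"
proof -
  obtain C l where C: "jordan_frame C" and "p = frame_exp C l 1"
    by (rule interior_eq_frame_exp[OF p])
  then show ?thesis
    by (simp add: jinverse_frame_exp jinvsqrt_frame_exp quad_frame_exp_add)
qed

text \<open>\<open>quad p\<close> is the square of the self-adjoint, injective operator
  \<open>quad (frame_exp C l (1/2))\<close>.\<close>

lemma quad_pos: "v \<noteq> 0 \<Longrightarrow> 0 < inner v (quad p v)"
proof -
  assume "v \<noteq> 0"
  obtain C l where C: "jordan_frame C" and p: "p = frame_exp C l 1"
    by (rule interior_eq_frame_exp[OF p])
  have "inner v (quad p v) = inner v (quad (frame_exp C l (1/2)) (quad (frame_exp C l (1/2)) v))"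
    by (simp add: quad_frame_exp_add[OF C] p)
  also have "\<dots> = (norm (quad (frame_exp C l (1/2)) v))\<^sup>2"
    by (simp add: power2_norm_eq_inner quad_selfadjoint)
  also have "\<dots> > 0"
    using \<open>v \<noteq> 0\<close> quad_frame_exp_inverse[OF C, of l "- (1/2)" v]
    by (auto simp: quad_zero_right)
  finally show ?thesis .
qed

lemma quad_eq_zero_iff: "quad p v = 0 \<longleftrightarrow> v = 0"
  using quad_pos[of v] by (metis inner_zero_right less_irrefl quad_zero_right)

lemma quad_quad: "quad (quad p y) z = quad p (quad y (quad p z))"
  using interior_eq_frame_exp[OF p] quad_quad_frame_exp by metis

end

text \<open>On a frame of \<open>u\<close> the operator \<open>quad u\<close> acts by the squares of
  the eigenvalues, so its kernel detects boundary points of the cone.\<close>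

lemma interior_cone_of_squares_quad:
  assumes "u \<in> cone_of_squares" and inj: "\<And>v. quad u v = 0 \<Longrightarrow> v = 0"
  shows "u \<in> interior cone_of_squares"
proof -
  obtain y where y: "u = y \<star> y"
    using assms(1) by (auto simp: cone_of_squares_def)
  obtain C ev where "spectral_decomposition y C ev"
    by (rule spectral_theorem)
  then have C: "jordan_frame C" and yC: "y = (\<Sum>c\<in>C. ev c *\<^sub>R c)"
    by (simp_all add: spectral_decomposition_def)
  note oi = jordan_frame_orthogonal_idempotents[OF C]
  have u: "u = (\<Sum>c\<in>C. (ev c * ev c) *\<^sub>R c)"
    by (simp add: y yC sum_idempotents_mult_sum[OF oi])
  have "0 < ev c * ev c" if c: "c \<in> C" for c
  proof -
    have "quad u c = ((ev c * ev c) * (ev c * ev c)) *\<^sub>R c"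
      unfolding quad_def u sum_idempotents_mult_sum[OF oi]
      using c by (simp add: sum_idempotents_mult[OF oi] jprod_scaleR_right flip: scaleR_left_diff_distrib)
    moreover have "c \<noteq> 0"
      using oi c by (auto simp: orthogonal_idempotents_def)
    ultimately show ?thesis
      using inj[of c] by (cases "ev c = 0") (auto simp: zero_less_mult_iff)
  qed
  with C show ?thesis
    using eigenvalues_imp_interior_cone_of_squares[of u C "\<lambda>c. ev c * ev c"]
    by (simp add: u spectral_decomposition_def)
qed

text \<open>Connectedness: the image of the segment from \<open>junit\<close> to \<open>y\<close>
  starts in the open cone. If it left, it would meet the frontier at some \<open>quad p s\<close>
  with \<open>s\<close> in the open cone; but \<open>quad (quad p s)\<close> is injective by the
  fundamental formula, so \<open>quad p s\<close> would be interior.\<close>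

lemma quad_in_interior:
  fixes p y :: "'a::euclidean_jordan_algebra"
  assumes p: "p \<in> interior cone_of_squares" and y: "y \<in> interior cone_of_squares"
  shows "quad p y \<in> interior cone_of_squares"
proof (rule ccontr)
  assume not: "quad p y \<notin> interior cone_of_squares"
  define S where "S = quad p ` closed_segment junit y"
  have "connected S"
    unfolding S_def using linear_quad[of p]
    by (intro connected_continuous_image linear_continuous_on)
      (auto simp: linear_conv_bounded_linear)
  moreover have "S \<inter> interior cone_of_squares \<noteq> {}"
  proof -
    obtain C l where C: "jordan_frame C" and p: "p = frame_exp C l 1"
      by (rule interior_eq_frame_exp[OF p])
    have "quad p junit = frame_exp C l 2"
      using C by (simp add: p quad_junit_right frame_exp_def flip: exp_add
          add: sum_idempotents_mult_sum[OF C[THEN jordan_frame_orthogonal_idempotents]])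
    then have "quad p junit \<in> interior cone_of_squares"
      using frame_exp_in_interior[OF C] by simp
    then show ?thesis
      unfolding S_def by blast
  qed
  moreover have "S - interior cone_of_squares \<noteq> {}"
    using not unfolding S_def by blast
  ultimately have "S \<inter> frontier (interior cone_of_squares) \<noteq> {}"
    by (rule connected_Int_frontier)
  then obtain s where s: "s \<in> closed_segment junit y"
    and fr: "quad p s \<in> frontier (interior cone_of_squares)"
    unfolding S_def by blast
  have s: "s \<in> interior cone_of_squares"
    using s closed_segment_subset[OF junit_in_interior y convex_interior[OF convex_cone_of_squares]]
    by blast
  have "closure (interior cone_of_squares) \<subseteq> (cone_of_squares :: 'a set)"
    by (rule closure_minimal[OF interior_subset closed_cone_of_squares])
  with fr have "quad p s \<in> cone_of_squares" "quad p s \<notin> interior cone_of_squares"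
    by (auto simp: frontier_def)
  moreover have "v = 0" if "quad (quad p s) v = 0" for v
    using that by (simp add: quad_quad[OF p] quad_eq_zero_iff[OF p] quad_eq_zero_iff[OF s])
  ultimately show False
    using interior_cone_of_squares_quad by blast
qed

lemma jinverse_quad:
  assumes p: "p \<in> interior cone_of_squares" and y: "y \<in> interior cone_of_squares"
  shows "jinverse (quad p y) = quad (jinverse p) (jinverse y)"
proof -
  have "jinverse (quad p y)
      = quad (jinverse p) (quad (jinverse y) (quad (jinverse p) (quad p y)))"
    by (rule jinverse_unique[OF quad_in_interior[OF p y]])
      (simp add: quad_quad[OF p] quad_quad_jinverse[OF p] quad_quad_jinverse[OF y])
  then show ?thesis
    by (simp add: quad_jinverse_quad[OF p] jinverse_eq_quad[OF y, symmetric])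
qed

section \<open>The metric and its Christoffel symbols\<close>

text \<open>For another root \<open>T\<close> put \<open>D = T - S\<close>. From
  \<open>T^2 = S^2\<close> follows \<open>T D + D S = 0\<close>; on an eigenvector of
  \<open>D\<close> with nonzero eigenvalue this contradicts the positivity of \<open>S\<close> and
  the semidefiniteness of \<open>T\<close>.\<close>

lemma operator_invsqrt_eq:
  fixes A S :: "'a::euclidean_space \<Rightarrow> 'a"
  assumes S: "linear S" "\<And>u v. inner (S u) v = inner u (S v)"
    and pos: "\<And>v. v \<noteq> 0 \<Longrightarrow> 0 < inner v (S v)"
    and inv: "\<And>v. S (S (A v)) = v" "\<And>v. A (S (S v)) = v"
  shows "operator_invsqrt A = S"
  unfolding operator_invsqrt_def
proof (rule the_equality)
  have "0 \<le> inner v (S v)" for v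
    using pos[of v] by (cases "v = 0") auto
  then show "linear S \<and> (\<forall>u v. inner (S u) v = inner u (S v)) \<and> (\<forall>v. 0 \<le> inner v (S v)) \<and>
      (\<forall>v. S (S (A v)) = v)"
    using S inv by blast
next
  fix T
  assume "linear T \<and> (\<forall>u v. inner (T u) v = inner u (T v)) \<and> (\<forall>v. 0 \<le> inner v (T v)) \<and>
      (\<forall>v. T (T (A v)) = v)"
  then have T: "linear T" "\<And>u v. inner (T u) v = inner u (T v)"
    and psd: "\<And>v. 0 \<le> inner v (T v)" and TT: "\<And>v. T (T (A v)) = v"
    by auto
  have sq: "T (T v) = S (S v)" for v
    using TT[of "S (S v)"] by (simp add: inv)
  define D where "D v = T v - S v" for v
  have D: "linear D" "\<And>u v. inner (D u) v = inner u (D v)"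
    unfolding D_def[abs_def] using S T by (auto intro: linear_compose_sub simp: inner_simps)
  \<comment> \<open>Inside \<open>range D\<close> an eigenvector of the self-adjoint
    \<open>D\<close> cannot have eigenvalue zero.\<close>
  have "range D = {0}"
  proof (rule ccontr)
    assume ne: "range D \<noteq> {0}"
    have "subspace (range D)"
      by (rule linear_subspace_image[OF D(1) subspace_UNIV])
    then obtain z l where z: "z \<in> range D" "z \<noteq> 0" "D z = l *\<^sub>R z"
      using selfadjoint_eigenvector[OF D _ _ ne] by blast
    then obtain y where y: "z = D y" by auto
    have "inner z z = l * inner y z"
      using D(2)[of y z] z(3) y by simp
    then have "l \<noteq> 0"
      using z by auto
    have "T (D z) + D (S z) = 0"
      unfolding D_def by (simp add: linear_diff[OF T(1)] sq)
    then have "inner (T (D z)) z + inner (D (S z)) z = 0"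
      by (simp flip: inner_add_left)
    then have "l * (inner z (T z) + inner z (S z)) = 0"
      unfolding D(2)[of "S z" z] z(3) linear_cmul[OF T(1)]
      by (simp add: inner_commute distrib_left)
    then show False
      using \<open>l \<noteq> 0\<close> pos[OF z(2)] psd[of z] by simp
  qed
  then show "T = S"
    by (metis D_def eq_iff_diff_eq_0 ext rangeI singletonD)
qed

lemma local_inner_eq:
  assumes p: "p \<in> interior cone_of_squares"
  shows "local_inner p b z = inner (quad (jinverse p) b) z"
proof -
  have "operator_invsqrt (quad p) = quad (jinvsqrt p)"
    by (rule operator_invsqrt_eq)
      (simp_all add: linear_quad quad_selfadjoint quad_pos[OF jinvsqrt_in_interior[OF p]]
        quad_jinvsqrt_jinvsqrt[OF p] quad_jinverse_quad[OF p] quad_quad_jinverse[OF p])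
  then show ?thesis
    by (simp add: local_inner_def quad_selfadjoint quad_jinvsqrt_jinvsqrt[OF p])
qed

lemma quad_eq_quad_polar: "quad a v = quad_polar a a v"
  by (simp add: quad_def quad_polar_def scaleR_2)

lemma quad_polar_commute: "quad_polar a b v = quad_polar b a v"
  by (simp add: quad_polar_def jprod_commute add.commute)

lemma quad_add_left: "quad (p + h) v = quad p v + 2 *\<^sub>R quad_polar p h v + quad h v"
  by (simp add: quad_def quad_polar_def jprod_simps scaleR_2 jprod_commute algebra_simps)

text \<open>Moves \<open>z\<close> out of the triple product, so that the Christoffel term
  differentiating the metric in the direction \<open>z\<close> is represented by the vector
  \<open>quad b p\<close>.\<close>

lemma inner_quad_polar_self: "inner (quad_polar p z b) b = inner z (quad b p)"
proof -
  have "inner (p \<star> (z \<star> b)) b = inner z (b \<star> (p \<star> b))"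
    by (simp add: inner_jprod jprod_commute[of z b])
  moreover have "inner (z \<star> (p \<star> b)) b = inner z ((p \<star> b) \<star> b)"
    by (simp add: inner_jprod[of "p \<star> b"] jprod_commute[of z "p \<star> b"])
  moreover have "inner ((p \<star> z) \<star> b) b = inner z (p \<star> (b \<star> b))"
    by (simp add: inner_jprod jprod_commute[of "p \<star> z" b])
  ultimately show ?thesis
    by (simp add: quad_polar_def quad_def inner_simps jprod_commute scaleR_2)
qed

lemma quad_polar_bounded:
  obtains M where "M > 0"
    "\<And>a b v :: 'a::euclidean_jordan_algebra. norm (quad_polar a b v) \<le> M * norm a * norm b * norm v"
proof -
  obtain K where K: "K > 0" "\<And>a b :: 'a. norm (a \<star> b) \<le> norm a * norm b * K"
    using bounded_bilinear.pos_bounded[OF bounded_bilinear_jprod] by blast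
  have 1: "norm (a \<star> (b \<star> v)) \<le> K * K * norm a * norm b * norm v" for a b v :: 'a
  proof -
    have "norm (a \<star> (b \<star> v)) \<le> norm a * norm (b \<star> v) * K"
      by (rule K)
    also have "\<dots> \<le> norm a * (norm b * norm v * K) * K"
      using K by (intro mult_left_mono mult_right_mono) auto
    finally show ?thesis by (simp add: mult_ac)
  qed
  have 2: "norm ((a \<star> b) \<star> v) \<le> K * K * norm a * norm b * norm v" for a b v :: 'a
    using 1[of v a b] by (simp add: jprod_commute mult_ac)
  have "norm (quad_polar a b v) \<le> (3 * (K * K)) * norm a * norm b * norm v" for a b v :: 'a
  proof -
    have "norm (quad_polar a b v)
        \<le> norm (a \<star> (b \<star> v)) + norm (b \<star> (a \<star> v)) + norm ((a \<star> b) \<star> v)"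
      unfolding quad_polar_def
      by (rule order_trans[OF norm_triangle_ineq4 add_right_mono[OF norm_triangle_ineq]])
    then show ?thesis
      using 1[of a b v] 1[of b a v] 2[of a b v] by (simp add: mult_ac)
  qed
  then show ?thesis
    using K by (intro that[of "3 * (K * K)"]) auto
qed

lemma has_derivative_quadratic_remainder:
  fixes f :: "'a::real_normed_vector \<Rightarrow> 'b::real_normed_vector"
  assumes "bounded_linear D" "e > 0"
    and rem: "\<And>h. norm h < e \<Longrightarrow> norm (f (p + h) - f p - D h) \<le> C * (norm h)\<^sup>2"
  shows "(f has_derivative D) (at p)"
  unfolding has_derivative_at_alt
proof (intro conjI allI impI)
  fix r :: real assume "r > 0"
  define d where "d = min e (r / (\<bar>C\<bar> + 1))"
  have "d > 0"
    using \<open>e > 0\<close> \<open>r > 0\<close> by (simp add: d_def)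
  moreover have "norm (f y - f p - D (y - p)) \<le> r * norm (y - p)" if "norm (y - p) < d" for y
  proof -
    have "norm (f y - f p - D (y - p)) \<le> C * (norm (y - p))\<^sup>2"
      using rem[of "y - p"] that by (simp add: d_def)
    also have "\<dots> \<le> (\<bar>C\<bar> + 1) * norm (y - p) * norm (y - p)"
      by (simp add: power2_eq_square mult_right_mono flip: mult.assoc)
    also have "\<dots> \<le> r * norm (y - p)"
      using that by (intro mult_right_mono) (auto simp: d_def field_simps)
    finally show ?thesis .
  qed
  ultimately show "\<exists>d>0. \<forall>y. norm (y - p) < d \<longrightarrow> norm (f y - f p - D (y - p)) \<le> r * norm (y - p)"
    by blast
qed (rule assms(1))

lemma quad_polar_add_middle: "quad_polar p (h + k) v = quad_polar p h v + quad_polar p k v"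
  by (simp add: quad_polar_def jprod_simps)

lemma quad_polar_scaleR_middle: "quad_polar p (r *\<^sub>R h) v = r *\<^sub>R quad_polar p h v"
  by (simp add: quad_polar_def jprod_simps algebra_simps)

text \<open>The rule for an operator inverse: minus the inverse times the derivative of the operator
  times the inverse, where \<open>quad\<close> at \<open>p\<close> has derivative
  \<open>2 *\<^sub>R quad_polar p h\<close>. Using the resolvent identity twice leaves an error
  quadratic in \<open>h\<close>.\<close>

lemma has_derivative_quad_jinverse:
  fixes p v :: "'a::euclidean_jordan_algebra"
  assumes p: "p \<in> interior cone_of_squares"
  defines "B \<equiv> \<lambda>q. quad (jinverse q)"
  shows "((\<lambda>q. B q v) has_derivative (\<lambda>h. - (2 *\<^sub>R B p (quad_polar p h (B p v))))) (at p)"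
proof -
  obtain M where M: "M > 0"
    "\<And>a b v :: 'a. norm (quad_polar a b v) \<le> M * norm a * norm b * norm v"
    using quad_polar_bounded by blast
  have "bounded_linear (B p)"
    by (simp add: B_def linear_quad flip: linear_conv_bounded_linear)
  then obtain N where N: "N > 0" "\<And>v. norm (B p v) \<le> norm v * N"
    using bounded_linear.pos_bounded by blast
  \<comment> \<open>\<open>2 * norm p\<close> comes from the polar term of \<open>\<Delta>\<close>,
    and 1 from \<open>quad h\<close> with \<open>norm h \<le> 1\<close>.\<close>
  define K where "K = M * (2 * norm p + 1)"
  have K: "K > 0"
    using M by (simp add: K_def add_nonneg_pos)
  define \<Delta> where "\<Delta> h w = 2 *\<^sub>R quad_polar p h w + quad h w" for h w
  have quad_\<Delta>: "quad (p + h) w = quad p w + \<Delta> h w" for h w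
    by (simp add: \<Delta>_def quad_add_left)
  have \<Delta>_bound: "norm (\<Delta> h w) \<le> K * norm h * norm w" if "norm h \<le> 1" for h w
  proof -
    have "norm (\<Delta> h w) \<le> 2 * norm (quad_polar p h w) + norm (quad_polar h h w)"
      unfolding \<Delta>_def quad_eq_quad_polar by (rule norm_triangle_le) simp
    also have "\<dots> \<le> 2 * (M * norm p * norm h * norm w) + M * norm h * norm h * norm w"
      using M(2)[of p h w] M(2)[of h h w] by simp
    also have "\<dots> \<le> 2 * (M * norm p * norm h * norm w) + M * 1 * norm h * norm w"
      using M that by (intro add_left_mono mult_right_mono mult_left_mono) auto
    finally show ?thesis
      by (simp add: K_def algebra_simps)
  qed
  obtain e1 where e1: "e1 > 0" "ball p e1 \<subseteq> interior cone_of_squares"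
    using p open_interior openE by blast
  \<comment> \<open>The three bounds keep \<open>p + h\<close> in the open cone, validate the
    estimate of \<open>\<Delta>\<close>, and make the perturbation at most half as large as the
    lower bound of \<open>quad p\<close>.\<close>
  define e where "e = min e1 (min 1 (1 / (2 * N * K)))"
  have "e > 0"
    using e1 N K by (simp add: e_def)
  \<comment> \<open>The first summand bounds the contribution of \<open>quad h\<close>, the second
    the twice iterated resolvent term, with \<open>2 * N\<close> bounding
    \<open>B (p + h)\<close>.\<close>
  define C where "C = N * (M * norm (B p v)) + 2 * N * (K * (N * (K * norm (B p v))))"
  have "norm (B (p + h) v - B p v - - (2 *\<^sub>R B p (quad_polar p h (B p v)))) \<le> C * (norm h)\<^sup>2"
    if h: "norm h < e" for h
  proof -
    have h1: "norm h \<le> 1" and hK: "2 * N * (K * norm h) \<le> 1" and q: "p + h \<in> interior cone_of_squares"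
      using h N K subsetD[OF e1(2), of "p + h"] by (auto simp: e_def field_simps dist_norm)
    have quad_lower: "norm w \<le> 2 * N * norm (quad (p + h) w)" for w
    proof -
      have "norm w \<le> norm (quad p w) * N"
        using N(2)[of "quad p w"] by (simp add: B_def quad_jinverse_quad[OF p])
      also have "\<dots> \<le> (norm (quad (p + h) w) + K * norm h * norm w) * N"
      proof (rule mult_right_mono)
        have "norm (quad p w) \<le> norm (quad (p + h) w) + norm (\<Delta> h w)"
          using norm_triangle_ineq4[of "quad (p + h) w" "\<Delta> h w"] by (simp add: quad_\<Delta>)
        then show "norm (quad p w) \<le> norm (quad (p + h) w) + K * norm h * norm w"
          using \<Delta>_bound[OF h1, of w] by simp
      qed (use N in simp)
      finally have "2 * norm w \<le> 2 * N * norm (quad (p + h) w) + (2 * N * (K * norm h)) * norm w"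
        by (simp add: algebra_simps)
      also have "\<dots> \<le> 2 * N * norm (quad (p + h) w) + 1 * norm w"
        using hK by (intro add_left_mono mult_right_mono) auto
      finally show ?thesis by simp
    qed
    have Bq: "norm (B (p + h) w) \<le> 2 * N * norm w" for w
      using quad_lower[of "B (p + h) w"] by (simp add: B_def quad_quad_jinverse[OF q])
    have resolvent: "B (p + h) w = B p w - B (p + h) (\<Delta> h (B p w))" for w
    proof -
      have "w = quad (p + h) (B p w) - \<Delta> h (B p w)"
        by (simp add: quad_\<Delta> B_def quad_quad_jinverse[OF p])
      then have "B (p + h) w = B (p + h) (quad (p + h) (B p w) - \<Delta> h (B p w))"
        by simp
      then show ?thesis
        by (simp add: B_def quad_diff_right quad_jinverse_quad[OF q])
    qed
    let ?\<beta> = "B p v"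
    have "B p (\<Delta> h ?\<beta>) = 2 *\<^sub>R B p (quad_polar p h ?\<beta>) + B p (quad h ?\<beta>)"
      by (simp add: \<Delta>_def B_def quad_add_right quad_scaleR_right)
    then have "B (p + h) v - B p v - - (2 *\<^sub>R B p (quad_polar p h ?\<beta>))
        = B (p + h) (\<Delta> h (B p (\<Delta> h ?\<beta>))) - B p (quad h ?\<beta>)"
      unfolding resolvent[of v] resolvent[of "\<Delta> h ?\<beta>"] by simp
    also have "norm \<dots> \<le> norm (B (p + h) (\<Delta> h (B p (\<Delta> h ?\<beta>)))) + norm (B p (quad h ?\<beta>))"
      by (rule norm_triangle_ineq4)
    also have "\<dots> \<le> 2 * N * (K * norm h * (N * (K * norm h * norm ?\<beta>)))
        + N * (M * norm h * norm h * norm ?\<beta>)"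
    proof (rule add_mono)
      have "norm (B p (\<Delta> h ?\<beta>)) \<le> N * (K * norm h * norm ?\<beta>)"
        using order_trans[OF N(2) mult_right_mono[OF \<Delta>_bound[OF h1, of ?\<beta>]]] N(1)
        by (simp add: mult_ac)
      then have "norm (\<Delta> h (B p (\<Delta> h ?\<beta>))) \<le> K * norm h * (N * (K * norm h * norm ?\<beta>))"
        using \<Delta>_bound[OF h1, of "B p (\<Delta> h ?\<beta>)"] K
        by (meson mult_left_mono mult_nonneg_nonneg norm_ge_zero order_trans less_imp_le)
      then show "norm (B (p + h) (\<Delta> h (B p (\<Delta> h ?\<beta>))))
          \<le> 2 * N * (K * norm h * (N * (K * norm h * norm ?\<beta>)))"
        using Bq[of "\<Delta> h (B p (\<Delta> h ?\<beta>))"] N(1)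
        by (meson mult_left_mono mult_nonneg_nonneg order_trans less_imp_le zero_le_numeral)
      have "norm (quad h ?\<beta>) * N \<le> M * norm h * norm h * norm ?\<beta> * N"
        unfolding quad_eq_quad_polar using M(2) N(1) by (intro mult_right_mono) auto
      then show "norm (B p (quad h ?\<beta>)) \<le> N * (M * norm h * norm h * norm ?\<beta>)"
        using N(2)[of "quad h ?\<beta>"] by (simp add: mult.commute)
    qed
    also have "\<dots> = C * (norm h)\<^sup>2"
      by (simp add: C_def power2_eq_square algebra_simps)
    finally show ?thesis .
  qed
  moreover have "bounded_linear (\<lambda>h. - (2 *\<^sub>R B p (quad_polar p h (B p v))))"
  proof -
    have "linear (\<lambda>h. - (2 *\<^sub>R B p (quad_polar p h (B p v))))"
      by (rule linearI) (simp_all add: B_def quad_polar_add_middle quad_polar_scaleR_middle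
          quad_add_right quad_scaleR_right scaleR_right_distrib)
    then show ?thesis
      by (simp add: linear_conv_bounded_linear)
  qed
  ultimately show ?thesis
    using \<open>e > 0\<close> by (intro has_derivative_quadratic_remainder[of _ e _ _ C])
qed

lemma frechet_derivative_local_inner:
  fixes p :: "'a::euclidean_jordan_algebra"
  assumes p: "p \<in> interior cone_of_squares"
  shows "frechet_derivative (\<lambda>q. local_inner q b z) (at p) h
    = - 2 * inner (quad (jinverse p) (quad_polar p h (quad (jinverse p) b))) z"
proof -
  have "((\<lambda>q. inner (quad (jinverse q) b) z) has_derivative
      (\<lambda>h. inner (- (2 *\<^sub>R quad (jinverse p) (quad_polar p h (quad (jinverse p) b)))) z)) (at p)"
    by (rule has_derivative_inner_left[OF has_derivative_quad_jinverse[OF p]])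
  then have "((\<lambda>q. local_inner q b z) has_derivative
      (\<lambda>h. inner (- (2 *\<^sub>R quad (jinverse p) (quad_polar p h (quad (jinverse p) b)))) z)) (at p)"
    by (rule has_derivative_transform_within_open[OF _ open_interior p]) (simp add: local_inner_eq)
  from frechet_derivative_at[OF this] show ?thesis
    by (metis inner_minus_left inner_scaleR_left mult_minus_left)
qed

text \<open>With both vector arguments equal to \<open>a\<close>, the first two derivative terms
  coincide. In the third, self-adjointness turns \<open>a\<close> into the momentum
  \<open>b\<close>, and \<open>inner_quad_polar_self\<close> frees \<open>z\<close>.\<close>

lemma christoffel_local_inner:
  fixes p :: "'a::euclidean_jordan_algebra"
  assumes p: "p \<in> interior cone_of_squares" and b: "b = quad (jinverse p) a"
  shows "christoffel local_inner p a a z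
    = inner (quad b p) z - 2 * inner (quad (jinverse p) (quad_polar p a b)) z"
proof -
  have "inner (quad (jinverse p) (quad_polar p z b)) a = inner (quad_polar p z b) b"
    by (simp only: quad_selfadjoint b)
  also have "\<dots> = inner (quad b p) z"
    by (metis inner_quad_polar_self inner_commute)
  finally have "inner (quad (jinverse p) (quad_polar p z b)) a = inner (quad b p) z" .
  then show ?thesis
    by (simp add: christoffel_def frechet_derivative_local_inner[OF p] flip: b)
qed

section \<open>The geodesic equation\<close>

lemma linear_Basis_expansion:
  fixes f :: "'a::euclidean_space \<Rightarrow> 'b::real_vector"
  assumes "linear f"
  shows "f w = (\<Sum>i\<in>Basis. inner w i *\<^sub>R f i)"
proof -
  have "f w = f (\<Sum>i\<in>Basis. inner w i *\<^sub>R i)"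
    by (simp add: euclidean_representation)
  also have "\<dots> = (\<Sum>i\<in>Basis. inner w i *\<^sub>R f i)"
    by (simp only: linear_sum[OF assms] linear_cmul[OF assms])
  finally show ?thesis .
qed

text \<open>The chain rule applies to a fixed vector only; expanding the moving \<open>v s\<close>
  in \<open>Basis\<close> reduces the claim to scalar coefficients times such curves.\<close>

lemma has_vector_derivative_quad_jinverse:
  fixes g v :: "real \<Rightarrow> 'a::euclidean_jordan_algebra"
  assumes g: "(g has_vector_derivative g') (at t within I)" "g t \<in> interior cone_of_squares"
    and v: "(v has_vector_derivative v') (at t within I)"
  defines "B \<equiv> \<lambda>q. quad (jinverse q)"
  shows "((\<lambda>s. B (g s) (v s)) has_vector_derivative
    B (g t) v' - 2 *\<^sub>R B (g t) (quad_polar (g t) g' (B (g t) (v t)))) (at t within I)"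
proof -
  let ?D = "\<lambda>w. - (2 *\<^sub>R B (g t) (quad_polar (g t) g' (B (g t) w)))"
  have D: "((\<lambda>s. B (g s) w) has_vector_derivative ?D w) (at t within I)" for w
    using vector_derivative_diff_chain_within[OF g(1)
        has_derivative_at_withinI[OF has_derivative_quad_jinverse[OF g(2)]], of w]
    by (simp add: o_def B_def)
  have "linear ?D"
    by (auto intro!: linearI simp: B_def quad_polar_def quad_add_right quad_scaleR_right jprod_simps
        quad_diff_right algebra_simps)
  note expandD = linear_Basis_expansion[OF this]
  have expandB: "B q w = (\<Sum>i\<in>Basis. inner w i *\<^sub>R B q i)" for q w
    unfolding B_def by (rule linear_Basis_expansion[OF linear_quad])
  have "((\<lambda>s. \<Sum>i\<in>Basis. inner (v s) i *\<^sub>R B (g s) i) has_vector_derivative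
      (\<Sum>i\<in>Basis. inner (v t) i *\<^sub>R ?D i + inner v' i *\<^sub>R B (g t) i)) (at t within I)"
  proof (intro has_vector_derivative_sum has_vector_derivative_scaleR D)
    fix i :: 'a
    show "((\<lambda>s. inner (v s) i) has_real_derivative inner v' i) (at t within I)"
      using bounded_linear.has_vector_derivative[OF bounded_linear_inner_left v, of i]
      by (simp add: has_real_derivative_iff_has_vector_derivative)
  qed
  then show ?thesis
    unfolding sum.distrib expandD[of "v t", symmetric] expandB[symmetric] by simp
qed

text \<open>Written for the position \<open>g\<close> and the momentum \<open>b\<close>, the geodesic equation is a polynomial
  Hamiltonian system, with Hamiltonian \<open>\<langle>quad g b, b\<rangle> / 2\<close>.\<close>

definition geodesic_flow ::
    "real set \<Rightarrow> (real \<Rightarrow> 'a::euclidean_jordan_algebra) \<Rightarrow> (real \<Rightarrow> 'a) \<Rightarrow> bool" where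
  "geodesic_flow I g b \<longleftrightarrow> (\<forall>t\<in>I.
     (g has_vector_derivative quad (g t) (b t)) (at t within I) \<and>
     (b has_vector_derivative - quad (b t) (g t)) (at t within I))"

lemma geodesic_on_imp_flow:
  assumes "geodesic_on (interior cone_of_squares) local_inner I g g'"
  shows "geodesic_flow I g (\<lambda>t. quad (jinverse (g t)) (g' t))"
  unfolding geodesic_flow_def
proof
  fix t assume "t \<in> I"
  with assms obtain g'' where g: "g t \<in> interior cone_of_squares"
    "(g has_vector_derivative g' t) (at t within I)"
    "(g' has_vector_derivative g'' t) (at t within I)"
    and eq: "\<And>z. local_inner (g t) (g'' t) z + christoffel local_inner (g t) (g' t) (g' t) z = 0"
    unfolding geodesic_on_def by blast
  let ?B = "quad (jinverse (g t))"
  define b where "b = ?B (g' t)"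
  \<comment> \<open>\<open>r\<close> represents the weak equation: its left-hand side at
    \<open>z\<close> is \<open>inner r z\<close>, so testing with \<open>z = r\<close> gives
    \<open>r = 0\<close>.\<close>
  define r where "r = ?B (g'' t) + quad b (g t) - 2 *\<^sub>R ?B (quad_polar (g t) (g' t) b)"
  have "inner r r = 0"
    using eq[of r]
    by (simp add: r_def christoffel_local_inner[OF g(1) b_def] local_inner_eq[OF g(1)] inner_simps)
  then have "r = 0"
    by simp
  then have "?B (g'' t) - 2 *\<^sub>R ?B (quad_polar (g t) (g' t) b) = - quad b (g t)"
    by (simp add: r_def algebra_simps add_eq_0_iff)
  then show "(g has_vector_derivative quad (g t) (?B (g' t))) (at t within I) \<and>
      ((\<lambda>t. quad (jinverse (g t)) (g' t)) has_vector_derivative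
        - quad (?B (g' t)) (g t)) (at t within I)"
    using has_vector_derivative_quad_jinverse[OF g(2,1,3)] g(2)
    by (simp add: b_def quad_quad_jinverse[OF g(1)])
qed

text \<open>The flow equation makes sense on the whole algebra, so membership in the open cone has
  to be supplied. The acceleration comes from the product rule for \<open>quad (g t) (b t)\<close>,
  and its polar term cancels the one in the Christoffel symbol.\<close>

lemma flow_imp_geodesic_on:
  assumes flow: "geodesic_flow I g b"
    and inside: "\<And>t. t \<in> I \<Longrightarrow> g t \<in> interior cone_of_squares"
  shows "geodesic_on (interior cone_of_squares) local_inner I g (\<lambda>t. quad (g t) (b t))"
  unfolding geodesic_on_def
proof (intro exI ballI conjI allI)
  fix t z assume t: "t \<in> I"
  let ?v = "quad (g t) (b t)"
  have g: "(g has_vector_derivative ?v) (at t within I)"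
    and b: "(b has_vector_derivative - quad (b t) (g t)) (at t within I)"
    using flow t by (auto simp: geodesic_flow_def)
  show "g t \<in> interior cone_of_squares" "(g has_vector_derivative ?v) (at t within I)"
    using inside t g by auto
  show "((\<lambda>t. quad (g t) (b t)) has_vector_derivative
      2 *\<^sub>R quad_polar (quad (g t) (b t)) (g t) (b t) + quad (g t) (- quad (b t) (g t)))
      (at t within I)"
    by (rule has_vector_derivative_quad[OF g b])
  have "b t = quad (jinverse (g t)) ?v"
    by (simp add: quad_jinverse_quad[OF inside[OF t]])
  from christoffel_local_inner[OF inside[OF t] this]
  show "local_inner (g t)
      (2 *\<^sub>R quad_polar (quad (g t) (b t)) (g t) (b t) + quad (g t) (- quad (b t) (g t))) z
      + christoffel local_inner (g t) ?v ?v z = 0"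
    by (simp add: local_inner_eq[OF inside[OF t]] quad_add_right quad_diff_right quad_minus_right
        quad_scaleR_right quad_jinverse_quad[OF inside[OF t]] inner_simps quad_polar_commute[of ?v])
qed

section \<open>Uniqueness for the geodesic flow\<close>

lemma gronwall_zero:
  fixes y :: "real \<Rightarrow> 'a::real_inner"
  assumes y: "\<And>t. t \<in> {0..1} \<Longrightarrow> (y has_vector_derivative y' t) (at t within {0..1})"
    and bound: "\<And>t. t \<in> {0..1} \<Longrightarrow> norm (y' t) \<le> K * norm (y t)"
    and "y 0 = 0" and t: "t \<in> {0..1}"
  shows "y t = 0"
proof (cases "t = 0")
  case False
  \<comment> \<open>The weight makes the squared norm nonincreasing, since its growth rate is at
    most \<open>2 * K\<close>; the mean value theorem then suffices.\<close>
  define \<phi> where "\<phi> s = inner (y s) (y s) * exp (- (2 * K * s))" for s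
  define \<phi>' where "\<phi>' s = (2 * inner (y s) (y' s) - 2 * K * inner (y s) (y s)) * exp (- (2 * K * s))"
    for s
  have "(\<phi> has_derivative (*) (\<phi>' s)) (at s within {0..t})" if "0 \<le> s" "s \<le> t" for s
  proof -
    have "(y has_vector_derivative y' s) (at s within {0..t})"
      using y[of s] that t by (auto intro: has_vector_derivative_within_subset)
    from bounded_bilinear.has_vector_derivative[OF bounded_bilinear_inner this this]
    have yy: "((\<lambda>s. inner (y s) (y s)) has_real_derivative
        inner (y s) (y' s) + inner (y' s) (y s)) (at s within {0..t})"
      by (simp add: has_real_derivative_iff_has_vector_derivative)
    have "(\<phi> has_real_derivative \<phi>' s) (at s within {0..t})"
      unfolding \<phi>_def[abs_def] \<phi>'_def
      by (rule derivative_eq_intros yy refl)+ (simp add: inner_commute algebra_simps)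
    then show ?thesis
      by (simp add: has_field_derivative_def)
  qed
  then obtain s where s: "s \<in> {0<..<t}" "\<phi> t - \<phi> 0 = \<phi>' s * (t - 0)"
    using mvt_simple[of 0 t \<phi> "\<lambda>s. (*) (\<phi>' s)"] False t by auto
  have "inner (y s) (y' s) \<le> norm (y s) * norm (y' s)"
    by (rule norm_cauchy_schwarz)
  also have "\<dots> \<le> norm (y s) * (K * norm (y s))"
    using bound[of s] s t by (intro mult_left_mono) auto
  finally have "\<phi>' s \<le> 0"
    by (simp add: \<phi>'_def mult_le_0_iff dot_square_norm power2_eq_square mult.left_commute)
  then have "\<phi>' s * t \<le> 0"
    using t by (intro mult_nonpos_nonneg) auto
  then have "\<phi> t \<le> \<phi> 0"
    using s by simp
  then have "inner (y t) (y t) \<le> 0"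
    using \<open>y 0 = 0\<close> by (simp add: \<phi>_def mult_le_0_iff)
  then show ?thesis
    by (metis inner_eq_zero_iff inner_ge_zero order_antisym)
qed (use \<open>y 0 = 0\<close> in simp)

text \<open>A difference of squares: \<open>quad a v - quad b w\<close> is
  \<open>quad_polar (a - b) (a + b) v\<close> plus \<open>quad b (v - w)\<close>, and
  \<open>norm (a + b) \<le> 2 * R\<close>.\<close>

lemma quad_lipschitz:
  fixes R :: real
  assumes "R \<ge> 0"
  obtains K where "K \<ge> 0" "\<And>a b v w :: 'a::euclidean_jordan_algebra.
    norm a \<le> R \<Longrightarrow> norm b \<le> R \<Longrightarrow> norm v \<le> R \<Longrightarrow>
    norm (quad a v - quad b w) \<le> K * (norm (a - b) + norm (v - w))"
proof -
  obtain M where M: "M > 0"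
    "\<And>a b v :: 'a. norm (quad_polar a b v) \<le> M * norm a * norm b * norm v"
    using quad_polar_bounded by blast
  have "norm (quad a v - quad b w) \<le> (2 * M * R * R) * (norm (a - b) + norm (v - w))"
    if *: "norm a \<le> R" "norm b \<le> R" "norm v \<le> R" for a b v w :: 'a
  proof -
    have ab: "norm (a + b) \<le> 2 * R"
      using norm_triangle_ineq[of a b] * by simp
    have "quad a v - quad b w = quad_polar (a - b) (a + b) v + quad_polar b b (v - w)"
      by (simp add: quad_def quad_polar_def jprod_simps scaleR_2 jprod_commute algebra_simps)
    also have "norm \<dots> \<le> M * norm (a - b) * norm (a + b) * norm v + M * norm b * norm b * norm (v - w)"
      using M(2)[of "a - b" "a + b" v] M(2)[of b b "v - w"]
      by (intro norm_triangle_le add_mono)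
    also have "\<dots> \<le> M * norm (a - b) * (2 * R) * R + M * R * R * norm (v - w)"
      using M(1) * ab assms by (intro add_mono mult_mono) auto
    also have "\<dots> \<le> M * norm (a - b) * (2 * R) * R + (2 * (M * R * R)) * norm (v - w)"
      using M(1) assms by (intro add_left_mono mult_right_mono) auto
    finally show ?thesis
      by (simp add: algebra_simps)
  qed
  moreover have "0 \<le> 2 * M * R * R"
    using M(1) assms by simp
  ultimately show ?thesis
    using that by blast
qed

lemma geodesic_flow_continuous:
  assumes "geodesic_flow I g b"
  shows "continuous_on I g" "continuous_on I b"
  using assms continuous_on_vector_derivative[of I g "\<lambda>t. quad (g t) (b t)"]
    continuous_on_vector_derivative[of I b "\<lambda>t. - quad (b t) (g t)"]
  by (simp_all add: geodesic_flow_def)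

text \<open>On the compact interval both solutions stay in one ball, where the vector field is
  Lipschitz. The factor 4 arises from two components, each bounded by \<open>K\<close> times two
  norms not exceeding \<open>norm (y t)\<close>.\<close>

lemma geodesic_flow_unique:
  assumes flow: "geodesic_flow {0..1} g b" "geodesic_flow {0..1} h c"
    and init: "g 0 = h 0" "b 0 = c 0" and t: "t \<in> {0..1}"
  shows "g t = h t"
proof -
  have cont: "continuous_on {0..1} g" "continuous_on {0..1} b"
    "continuous_on {0..1} h" "continuous_on {0..1} c"
    by (rule geodesic_flow_continuous[OF flow(1)] geodesic_flow_continuous[OF flow(2)])+
  define U where "U = g ` {0..1} \<union> b ` {0..1} \<union> h ` {0..1} \<union> c ` {0..1}"
  have "bounded U"
    unfolding U_def bounded_Un
    by (intro conjI compact_imp_bounded compact_continuous_image cont compact_Icc)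
  then obtain R where "R > 0" and R: "\<And>x. x \<in> U \<Longrightarrow> norm x \<le> R"
    unfolding bounded_pos by blast
  obtain K where K: "K \<ge> 0" "\<And>a b v w :: 'a. norm a \<le> R \<Longrightarrow> norm b \<le> R \<Longrightarrow> norm v \<le> R \<Longrightarrow>
      norm (quad a v - quad b w) \<le> K * (norm (a - b) + norm (v - w))"
    using quad_lipschitz[of R] \<open>R > 0\<close> by (metis less_imp_le)
  define y where "y t = (g t - h t, b t - c t)" for t
  define y' where "y' t = (quad (g t) (b t) - quad (h t) (c t),
      - quad (b t) (g t) - (- quad (c t) (h t)))" for t
  have "y t = 0"
  proof (rule gronwall_zero[OF _ _ _ t])
    fix t :: real assume t: "t \<in> {0..1}"
    show "(y has_vector_derivative y' t) (at t within {0..1})"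
      unfolding y_def[abs_def] y'_def using flow t
      by (intro has_vector_derivative_Pair has_vector_derivative_diff)
        (auto simp: geodesic_flow_def)
    have gh: "norm (g t - h t) \<le> norm (y t)" and bc: "norm (b t - c t) \<le> norm (y t)"
      unfolding y_def by (rule norm_fst_le norm_snd_le)+
    have "norm (y' t) \<le> norm (quad (g t) (b t) - quad (h t) (c t))
        + norm (- quad (b t) (g t) - (- quad (c t) (h t)))"
      unfolding y'_def by (rule norm_Pair_le)
    also have "\<dots> = norm (quad (g t) (b t) - quad (h t) (c t))
        + norm (quad (b t) (g t) - quad (c t) (h t))"
      by (simp add: norm_minus_commute)
    also have "\<dots> \<le> K * (norm (g t - h t) + norm (b t - c t))
        + K * (norm (b t - c t) + norm (g t - h t))"
      using t by (intro add_mono K R) (auto simp: U_def)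
    also have "\<dots> \<le> K * (norm (y t) + norm (y t)) + K * (norm (y t) + norm (y t))"
      using gh bc K(1) by (intro add_mono mult_left_mono) auto
    finally show "norm (y' t) \<le> (4 * K) * norm (y t)"
      by (simp add: algebra_simps)
  qed (simp add: y_def init zero_prod_def)
  then show ?thesis
    by (simp add: y_def zero_prod_def)
qed

section \<open>The exponential map\<close>

text \<open>Initial velocity and initial momentum determine each other because
  \<open>quad (g 0)\<close> is invertible. Hence every competing geodesic yields a flow with the
  same initial data, and the definite description is well defined.\<close>

lemma riemannian_exp_eq_flow:
  assumes flow: "geodesic_flow {0..1} g b"
    and inside: "\<And>t. t \<in> {0..1} \<Longrightarrow> g t \<in> interior cone_of_squares"
  shows "cone_Exp (g 0) (quad (g 0) (b 0)) = g 1"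
  unfolding cone_Exp_def riemannian_exp_def
proof (rule the_equality)
  show "\<exists>h h'. geodesic_on (interior cone_of_squares) local_inner {0..1} h h' \<and> h 0 = g 0 \<and>
      h' 0 = quad (g 0) (b 0) \<and> g 1 = h 1"
    using flow_imp_geodesic_on[OF flow inside]
    by (intro exI[of _ g] exI[of _ "\<lambda>t. quad (g t) (b t)"]) auto
next
  fix y
  assume "\<exists>h h'. geodesic_on (interior cone_of_squares) local_inner {0..1} h h' \<and> h 0 = g 0 \<and>
      h' 0 = quad (g 0) (b 0) \<and> y = h 1"
  then obtain h h' where h: "geodesic_on (interior cone_of_squares) local_inner {0..1} h h'"
    "h 0 = g 0" "h' 0 = quad (g 0) (b 0)" "y = h 1"
    by blast
  have "g 1 = h 1"
  proof (rule geodesic_flow_unique[OF flow geodesic_on_imp_flow[OF h(1)]])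
    show "b 0 = quad (jinverse (h 0)) (h' 0)"
      using inside[of 0] by (simp add: h quad_jinverse_quad)
  qed (simp_all add: h)
  then show "y = g 1"
    by (simp add: h)
qed

text \<open>The fundamental formula carries the flow equations from the base point
  \<open>junit\<close> to \<open>p \<star> p\<close>. At \<open>junit\<close> everything lies in one
  frame of \<open>d\<close>, and \<open>quad1\<close> and \<open>quad2\<close> are identities
  between coefficients.\<close>

lemma cone_Exp_quad:
  fixes p d :: "'a::euclidean_jordan_algebra"
  assumes p: "p \<in> interior cone_of_squares"
  shows "cone_Exp (p \<star> p) (quad p d) = quad p (jexp d)"
proof -
  obtain C l where spec: "spectral_decomposition d C l"
    by (rule spectral_theorem)
  then have C: "jordan_frame C" and d: "d = (\<Sum>c\<in>C. l c *\<^sub>R c)"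
    by (simp_all add: spectral_decomposition_def)
  note oi = jordan_frame_orthogonal_idempotents[OF C]
  define E where "E = frame_exp C l"
  define g where "g t = quad p (E t)" for t
  define b where "b t = quad (jinverse p) (d \<star> E (- t))" for t
  have E: "(E has_vector_derivative d \<star> E t) (at t within I)"
    "((\<lambda>s. E (- s)) has_vector_derivative - (d \<star> E (- t))) (at t within I)" for t I
  proof -
    have "((\<lambda>s. s) has_real_derivative 1) (at t within I)"
      "(uminus has_real_derivative - 1) (at t within I)"
      by (auto intro!: derivative_eq_intros)
    from this[THEN has_vector_derivative_frame_exp[OF C, of _ _ _ _ l]]
    show "(E has_vector_derivative d \<star> E t) (at t within I)"
      "((\<lambda>s. E (- s)) has_vector_derivative - (d \<star> E (- t))) (at t within I)"
      by (simp_all add: E_def d)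
  qed
  have dE: "d \<star> E (- t) = (\<Sum>c\<in>C. (l c * exp (- t * l c)) *\<^sub>R c)" for t
    by (simp add: d E_def frame_exp_def sum_idempotents_mult_sum[OF oi])
  have quad1: "quad (E t) (d \<star> E (- t)) = d \<star> E t" for t
    unfolding dE d unfolding E_def frame_exp_def quad_sum_idempotents[OF oi]
      sum_idempotents_mult_sum[OF oi]
    by (intro sum.cong) (simp_all add: exp_minus field_simps)
  have quad2: "quad (d \<star> E (- t)) (E t) = d \<star> (d \<star> E (- t))" for t
    unfolding dE unfolding d E_def frame_exp_def quad_sum_idempotents[OF oi]
      sum_idempotents_mult_sum[OF oi]
    by (intro sum.cong) (simp_all add: exp_minus field_simps)
  have "geodesic_flow {0..1} g b"
    unfolding geodesic_flow_def
  proof (intro ballI conjI)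
    fix t :: real assume "t \<in> {0..1}"
    have lin: "bounded_linear (quad q)" for q :: 'a
      by (simp add: linear_quad flip: linear_conv_bounded_linear)
    have "quad (g t) (b t) = quad p (d \<star> E t)"
      by (simp add: g_def b_def quad_quad[OF p] quad_quad_jinverse[OF p] quad1)
    then show "(g has_vector_derivative quad (g t) (b t)) (at t within {0..1})"
      unfolding g_def[abs_def] using bounded_linear.has_vector_derivative[OF lin E(1)] by simp
    have "- quad (b t) (g t) = quad (jinverse p) (d \<star> - (d \<star> E (- t)))"
      by (simp add: g_def b_def quad_quad[OF jinverse_in_interior[OF p]] quad_jinverse_quad[OF p]
          quad2 quad_minus_right jprod_minus_right)
    moreover have "((\<lambda>s. d \<star> E (- s)) has_vector_derivative d \<star> - (d \<star> E (- t))) (at t within {0..1})"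
      by (intro bounded_linear.has_vector_derivative[OF
            bounded_bilinear.bounded_linear_right[OF bounded_bilinear_jprod]] E)
    ultimately show "(b has_vector_derivative - quad (b t) (g t)) (at t within {0..1})"
      unfolding b_def[abs_def] using bounded_linear.has_vector_derivative[OF lin] by simp
  qed
  moreover have "g t \<in> interior cone_of_squares" for t
    unfolding g_def E_def by (rule quad_in_interior[OF p frame_exp_in_interior[OF C]])
  ultimately have "cone_Exp (g 0) (quad (g 0) (b 0)) = g 1"
    by (rule riemannian_exp_eq_flow)
  moreover have "g 0 = p \<star> p"
    by (simp add: g_def E_def frame_exp_0[OF C] quad_junit_right)
  moreover have "quad (g 0) (b 0) = quad p d"
    using quad1[of 0]
    by (simp add: g_def b_def quad_quad[OF p] quad_quad_jinverse[OF p] E_def frame_exp_0[OF C]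
        junit_right)
  moreover have "g 1 = quad p (jexp d)"
    by (simp add: g_def E_def frame_exp_def jexp_def spectral_map_eq[OF spec])
  ultimately show ?thesis by simp
qed

lemma jexp_frame_exp: "spectral_decomposition d C l \<Longrightarrow> jexp (r *\<^sub>R d) = frame_exp C l r"
proof -
  assume "spectral_decomposition d C l"
  then have "spectral_decomposition (r *\<^sub>R d) C (\<lambda>c. r * l c)"
    by (simp add: spectral_decomposition_def scaleR_sum_right)
  then show ?thesis
    by (simp add: jexp_def spectral_map_eq frame_exp_def)
qed

lemma jexp_in_interior: "jexp d \<in> interior cone_of_squares"
proof -
  obtain C l where C: "spectral_decomposition d C l"
    by (rule spectral_theorem)
  then show ?thesis
    using jexp_frame_exp[OF C, of 1] frame_exp_in_interior[of C l 1]
    by (simp add: spectral_decomposition_def)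
qed

lemma jinverse_jexp: "jinverse (jexp d) = jexp (- d)"
proof -
  obtain C l where C: "spectral_decomposition d C l"
    by (rule spectral_theorem)
  then show ?thesis
    using jexp_frame_exp[OF C, of 1] jexp_frame_exp[OF C, of "- 1"] jinverse_frame_exp[of C l 1]
    by (simp add: spectral_decomposition_def)
qed

lemma scaleR_in_interior:
  assumes "u \<in> interior cone_of_squares" "r > 0"
  shows "r *\<^sub>R u \<in> interior cone_of_squares"
proof -
  obtain C ev where "spectral_decomposition u C ev" and "\<And>c. c \<in> C \<Longrightarrow> 0 < ev c"
    using interior_cone_of_squares_eigenvalues[OF assms(1)] by blast
  then show ?thesis
    using \<open>r > 0\<close> eigenvalues_imp_interior_cone_of_squares[of "r *\<^sub>R u" C "\<lambda>c. r * ev c"]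
    by (simp add: spectral_decomposition_def scaleR_sum_right)
qed

text \<open>The scalar is absorbed into the base: \<open>sqrt r *\<^sub>R p\<close> has square
  \<open>r *\<^sub>R (p \<star> p)\<close>, and its \<open>quad\<close> is \<open>r\<close> times
  that of \<open>p\<close>.\<close>

lemma cone_Exp_scaled_quad:
  assumes p: "p \<in> interior cone_of_squares" and "r > 0"
  shows "cone_Exp (r *\<^sub>R (p \<star> p)) (r *\<^sub>R quad p d) = r *\<^sub>R quad p (jexp d)"
  using cone_Exp_quad[OF scaleR_in_interior[OF p, of "sqrt r"], of d] \<open>r > 0\<close>
  by (simp add: jprod_simps quad_scaleR_left)

theorem proposition2p2:
  fixes L :: "'a::euclidean_jordan_algebra set"
    and x0 s0 w d x s dx ds :: 'a
    and \<mu> :: real and n :: nat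
  assumes "jrank TYPE('a) = n"
    and "subspace L"
    and "interior cone_of_squares \<inter> (+) x0 ` L \<noteq> {}"
    and "interior cone_of_squares \<inter> (+) s0 ` (L\<^sup>\<bottom>) \<noteq> {}"
    and "w \<in> interior cone_of_squares"
    and "\<mu> > 0"
    and "d = newton_direction L x0 s0 w \<mu>"
    and "x = sqrt \<mu> *\<^sub>R w"
    and "s = sqrt \<mu> *\<^sub>R jinverse w"
    and "dx = sqrt \<mu> *\<^sub>R quad (jsqrt w) d"
    and "ds = - (sqrt \<mu> *\<^sub>R quad (jinvsqrt w) d)"
  shows "cone_Exp x dx = sqrt \<mu> *\<^sub>R quad (jsqrt w) (jexp d)
       \<and> cone_Exp s ds = sqrt \<mu> *\<^sub>R quad (jinvsqrt w) (jexp (- d))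
       \<and> cone_Exp x dx \<star> cone_Exp s ds = \<mu> *\<^sub>R junit"
proof -
  obtain C l where C: "jordan_frame C" and w: "w = frame_exp C l 1"
    by (rule interior_eq_frame_exp[OF \<open>w \<in> interior cone_of_squares\<close>])
  \<comment> \<open>Both exponentials become instances of one lemma: base \<open>a\<close> with
    direction \<open>d\<close>, and base \<open>jinverse a\<close> with direction
    \<open>- d\<close>.\<close>
  define a where "a = jsqrt w"
  have a: "a \<in> interior cone_of_squares"
    unfolding a_def by (rule jsqrt_in_interior[OF \<open>w \<in> interior cone_of_squares\<close>])
  have inv: "jinvsqrt w = jinverse a"
    by (simp add: a_def w jsqrt_frame_exp[OF C] jinvsqrt_frame_exp[OF C] jinverse_frame_exp[OF C])
  have square: "frame_exp C l t \<star> frame_exp C l t = frame_exp C l (2 * t)" for t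
    unfolding frame_exp_def sum_idempotents_mult_sum[OF jordan_frame_orthogonal_idempotents[OF C]]
    by (simp add: mult.assoc flip: exp_add)
  have aa: "a \<star> a = w" "jinverse a \<star> jinverse a = jinverse w"
    by (simp_all add: a_def w jsqrt_frame_exp[OF C] jinverse_frame_exp[OF C] square)
  have X: "cone_Exp x dx = sqrt \<mu> *\<^sub>R quad a (jexp d)"
    using cone_Exp_scaled_quad[OF a, of "sqrt \<mu>" d] assms aa by (simp add: a_def)
  have S: "cone_Exp s ds = sqrt \<mu> *\<^sub>R quad (jinverse a) (jexp (- d))"
    using cone_Exp_scaled_quad[OF jinverse_in_interior[OF a], of "sqrt \<mu>" "- d"] assms aa
    by (simp add: inv quad_minus_right)
  \<comment> \<open>Without the factors \<open>sqrt \<mu>\<close> the two end points are mutually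
    inverse, so their product is \<open>junit\<close>.\<close>
  have "quad (jinverse a) (jexp (- d)) = jinverse (quad a (jexp d))"
    by (simp add: jinverse_quad[OF a jexp_in_interior] jinverse_jexp)
  then have "cone_Exp x dx \<star> cone_Exp s ds = \<mu> *\<^sub>R junit"
    unfolding X S using \<open>\<mu> > 0\<close>
    by (simp add: jprod_simps jprod_jinverse[OF quad_in_interior[OF a jexp_in_interior]])
  with X S show ?thesis
    by (simp add: a_def inv)
qed

end
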